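(* $\displaystyle \limsup_{d\to\infty} \frac{h_{**}(d)}{h_{\mathrm{as}}(d)} \leq 1.$
   Context: For $d \geq 3$, let $g(x,y)=\sum_{n\ge0}P_x[X_n=y]$ be the Green function of simple random walk on $\mathbb{Z}^d$, $g(0)=g(0,0)$. Under $\mathbb{P}$, $\varphi=(\varphi_x)_{x\in\mathbb{Z}^d}$ is a centered Gaussian field with $\mathbb{E}[\varphi_x\varphi_y]=g(x,y)$ (Gaussian free field). For $h\in\mathbb{R}$, $E_\varphi^{\geq h}=\{x:\varphi_x\ge h\}$. For $L\ge 1$, $B(0,L)$ is the $\ell^\infty$-ball of radius $L$ around $0$ and $S(0,2L)$ the $\ell^\infty$-sphere of radius $2L$ around $0$; $\{B(0,L)\stackrel{\ge h}{\longleftrightarrow}S(0,2L)\}$ is the event that there is a nearest-neighbour path in $E_\varphi^{\ge h}$ from $B(0,L)$ to $S(0,2L)$. Define $h_{**}(d)=\inf\{h\in\mathbb{R}:\lim_{L\to\infty}\mathbb{P}[B(0,L)\stackrel{\ge h}{\longleftrightarrow}S(0,2L)]=0\}$ and $h_{\mathrm{as}}(d)=\sqrt{2g(0)\log d}$. *)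

theory Defs
  imports "HOL-Probability.Probability"
begin

text \<open>Points of Z^d are represented as functions nat => int vanishing at all indices >= d.\<close>

definition lattice :: "nat \<Rightarrow> (nat \<Rightarrow> int) set" where
  "lattice d = {x. \<forall>i\<ge>d. x i = 0}"

definition unit_vec :: "nat \<Rightarrow> nat \<Rightarrow> int" where
  "unit_vec i = (\<lambda>j. if j = i then 1 else 0)"

fun srw_prob :: "nat \<Rightarrow> nat \<Rightarrow> (nat \<Rightarrow> int) \<Rightarrow> (nat \<Rightarrow> int) \<Rightarrow> real" where
  "srw_prob d 0 x y = (if x = y then 1 else 0)"
| "srw_prob d (Suc n) x y =
     (\<Sum>i<d. srw_prob d n (\<lambda>j. x j + unit_vec i j) y + srw_prob d n (\<lambda>j. x j - unit_vec i j) y) / (2 * real d)"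

definition green :: "nat \<Rightarrow> (nat \<Rightarrow> int) \<Rightarrow> (nat \<Rightarrow> int) \<Rightarrow> real" where
  "green d x y = (\<Sum>n. srw_prob d n x y)"

definition green0 :: "nat \<Rightarrow> real" where
  "green0 d = green d (\<lambda>_. 0) (\<lambda>_. 0)"

text \<open>phi is a centered Gaussian field on Z^d with covariance g under M: every finite linear
  combination sum c_x phi_x has the centered normal law with variance sum c_x c_y g(x,y)
  (characterised by its characteristic function).\<close>
definition is_GFF :: "nat \<Rightarrow> 'a measure \<Rightarrow> ((nat \<Rightarrow> int) \<Rightarrow> 'a \<Rightarrow> real) \<Rightarrow> bool" where
  "is_GFF d M phi \<longleftrightarrow> prob_space M \<and>
     (\<forall>x\<in>lattice d. phi x \<in> borel_measurable M) \<and>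
     (\<forall>F c. finite F \<and> F \<subseteq> lattice d \<longrightarrow>
        (\<forall>t::real. char (distr M borel (\<lambda>\<omega>. \<Sum>x\<in>F. c x * phi x \<omega>)) t =
           complex_of_real (exp (- (\<Sum>x\<in>F. \<Sum>y\<in>F. c x * c y * green d x y) * t\<^sup>2 / 2))))"

definition ball_inf :: "nat \<Rightarrow> nat \<Rightarrow> (nat \<Rightarrow> int) set" where
  "ball_inf d L = {x \<in> lattice d. \<forall>i<d. \<bar>x i\<bar> \<le> int L}"

definition sphere_inf :: "nat \<Rightarrow> nat \<Rightarrow> (nat \<Rightarrow> int) set" where
  "sphere_inf d R = {x \<in> lattice d. (\<forall>i<d. \<bar>x i\<bar> \<le> int R) \<and> (\<exists>i<d. \<bar>x i\<bar> = int R)}"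

definition nn :: "nat \<Rightarrow> (nat \<Rightarrow> int) \<Rightarrow> (nat \<Rightarrow> int) \<Rightarrow> bool" where
  "nn d x y \<longleftrightarrow> x \<in> lattice d \<and> y \<in> lattice d \<and> (\<Sum>i<d. \<bar>x i - y i\<bar>) = 1"

definition crossing :: "nat \<Rightarrow> 'a measure \<Rightarrow> ((nat \<Rightarrow> int) \<Rightarrow> 'a \<Rightarrow> real) \<Rightarrow> real \<Rightarrow> nat \<Rightarrow> 'a set" where
  "crossing d M phi h L = {\<omega> \<in> space M. \<exists>p. p \<noteq> [] \<and> hd p \<in> ball_inf d L \<and> last p \<in> sphere_inf d (2 * L)
      \<and> set p \<subseteq> lattice d \<and> (\<forall>x\<in>set p. phi x \<omega> \<ge> h)
      \<and> (\<forall>k. Suc k < length p \<longrightarrow> nn d (p ! k) (p ! Suc k))}"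

definition h_ss :: "nat \<Rightarrow> 'a measure \<Rightarrow> ((nat \<Rightarrow> int) \<Rightarrow> 'a \<Rightarrow> real) \<Rightarrow> real" where
  "h_ss d M phi = Inf {h. ((\<lambda>L. measure M (crossing d M phi h L)) \<longlongrightarrow> 0) sequentially}"

definition h_as :: "nat \<Rightarrow> real" where
  "h_as d = sqrt (2 * green0 d * ln (real d))"

end

theory Submission
  imports Defs
begin

text \<open>
  A path in the level set that starts in \<open>B(0,L)\<close> and reaches \<open>S(0,2L)\<close> may be taken chordless. By
  repeatedly looking at its two ends one extracts from it \<open>2\<^sup>k\<close> chordless pieces with \<open>n = K d\<close>
  vertices each, arranged as the leaves of a dyadic tree with separation growing like \<open>5\<^sup>j\<close>. The
  Green function is at most of order \<open>1/d\<close> at distance one, of order \<open>1/d\<^sup>2\<close> further away and decays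
  polynomially, and every vertex of a chordless path has at most two neighbours on it. Hence the sum
  of the field over all \<open>n 2\<^sup>k\<close> vertices has variance at most \<open>n 2\<^sup>k (g(0) + O(1/d))\<close>. For
  \<open>h = (1 + \<epsilon>) h\<^sub>a\<^sub>s\<close> the Gaussian tail is therefore about \<open>d\<close> to the power \<open>-(1 + \<epsilon>) n 2\<^sup>k\<close>, which beats
  the number of such trees, roughly \<open>(d\<^sup>d (2d)\<^sup>n)\<close> to the power \<open>2\<^sup>k\<close>, once \<open>K\<close> is large.

  The infimum defining \<open>h\<^sub>*\<^sub>*\<close> is moreover finite: in a coordinate plane the Green function is
  summable, so a Peierls argument shows that very negative levels percolate.
\<close>

subsection \<open>A supersolution bounding the Green function\<close>

definition sqd :: "nat \<Rightarrow> (nat \<Rightarrow> int) \<Rightarrow> int" where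
  "sqd d z = (\<Sum>i<d. (z i)\<^sup>2)"

text \<open>Near field of the majorant. With 2 at the pole, the neighbour average at distance one is
  exactly \<open>1 / d\<close>; at the pole itself the surplus pays for the source term 1.\<close>

definition near :: "nat \<Rightarrow> int \<Rightarrow> real" where
  "near d u = (if u = 0 then 2 else if u = 1 then 1 / real d else 0)"

definition cgap :: real where
  "cgap = 2 * 33 ^ 3"

text \<open>Evaluated at the squared distance to the pole, this majorizes the Green function because it
  is a supersolution: the bound of order \<open>1/d\<close> at distance one pays for the pole, and the smooth
  far field, superharmonic for \<open>d \<ge> 16\<close>, pays for the defect of order \<open>1/d\<^sup>2\<close> at \<open>\<ell>\<^sup>1\<close>-distance
  two. There the squared distance is at most 4, so \<open>28 + 4 + 1 = 33\<close> enters the constant.\<close>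

definition gmaj :: "nat \<Rightarrow> int \<Rightarrow> real" where
  "gmaj d u = near d u + cgap / (real d)\<^sup>2 / (28 + real_of_int u)\<^sup>2"

lemma sqd_nonneg: "0 \<le> sqd d z"
  by (simp add: sqd_def sum_nonneg)

lemma sqd_ge_coord: "i < d \<Longrightarrow> (z i)\<^sup>2 \<le> sqd d z"
  unfolding sqd_def by (rule member_le_sum) auto

lemma sqd_shift:
  assumes "i < d" and "s\<^sup>2 = 1"
  shows "sqd d (\<lambda>j. x j + s * unit_vec i j - y j) = sqd d (\<lambda>j. x j - y j) + 1 + 2 * s * (x i - y i)"
proof -
  have "sqd d (\<lambda>j. x j + s * unit_vec i j - y j) =
     (\<Sum>j<d. (x j - y j)\<^sup>2 + (if j = i then 1 + 2 * s * (x i - y i) else 0))"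
    unfolding sqd_def
    using assms(2) by (intro sum.cong) (auto simp: unit_vec_def power2_eq_square algebra_simps)
  also have "\<dots> = sqd d (\<lambda>j. x j - y j) + (1 + 2 * s * (x i - y i))"
    using assms(1) by (simp add: sqd_def sum.distrib)
  finally show ?thesis by simp
qed

text \<open>With \<open>w = 4 * t\<^sup>2 / s\<^sup>2\<close> the left side equals
  \<open>2 / s\<^sup>2 * ((1 + w) / (1 - w)\<^sup>2)\<close>, and the hypotheses force
  \<open>w \<le> 1/7\<close>.\<close>

lemma far_term:
  fixes s t :: real
  assumes s: "29 \<le> s" and t: "t\<^sup>2 \<le> s"
  shows "1 / (s + 2 * t)\<^sup>2 + 1 / (s - 2 * t)\<^sup>2 \<le> 2 / s\<^sup>2 * (1 + 16 * t\<^sup>2 / s\<^sup>2)"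
proof -
  define w where "w = 4 * t\<^sup>2 / s\<^sup>2"
  have w0: "0 \<le> w" by (simp add: w_def)
  have "4 * t\<^sup>2 * 7 \<le> s * s"
    using s t mult_right_mono[of 28 s s] by linarith
  hence w1: "w \<le> 1/7" using s by (simp add: w_def field_simps power2_eq_square)
  have t2: "4 * t\<^sup>2 = w * s\<^sup>2" using s by (simp add: w_def)
  have ne: "s + 2*t \<noteq> 0" "s - 2*t \<noteq> 0"
  proof -
    have "(s + 2*t) * (s - 2*t) = s\<^sup>2 * (1 - w)"
      using t2 by (simp add: algebra_simps power2_eq_square)
    moreover have "s\<^sup>2 * (1 - w) > 0" using s w1 by simp
    ultimately show "s + 2*t \<noteq> 0" "s - 2*t \<noteq> 0" by auto
  qed
  have prod: "(s + 2*t)\<^sup>2 * (s - 2*t)\<^sup>2 = (s\<^sup>2 * (1 - w))\<^sup>2"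
    using t2 by (simp add: algebra_simps power2_eq_square flip: power_mult_distrib)
  have num: "(s - 2*t)\<^sup>2 + (s + 2*t)\<^sup>2 = 2 * (s\<^sup>2 * (1 + w))"
    using t2 by (simp add: algebra_simps power2_eq_square)
  have "1 / (s + 2 * t)\<^sup>2 + 1 / (s - 2 * t)\<^sup>2 = ((s - 2*t)\<^sup>2 + (s + 2*t)\<^sup>2) / ((s + 2*t)\<^sup>2 * (s - 2*t)\<^sup>2)"
    using ne by (simp add: add_frac_eq)
  also have "\<dots> = 2 / s\<^sup>2 * ((1 + w) / (1 - w)\<^sup>2)"
    unfolding prod num power_mult_distrib using s by (simp add: power2_eq_square)
  also have "\<dots> \<le> 2 / s\<^sup>2 * (1 + 4 * w)"
  proof -
    \<comment> \<open>This product is exactly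
      \<open>(1 + 4 * w) * (1 - w)\<^sup>2 - (1 + w)\<close>, which is why
      \<open>w \<le> 1/7\<close> is wanted.\<close>
    have "w * (1 - 7 * w + 4 * w\<^sup>2) \<ge> 0" using w0 w1 by (intro mult_nonneg_nonneg) auto
    hence "1 + w \<le> (1 + 4 * w) * (1 - w)\<^sup>2" by (simp add: algebra_simps power2_eq_square)
    hence "(1 + w) / (1 - w)\<^sup>2 \<le> 1 + 4 * w" using w1 by (simp add: divide_le_eq)
    thus ?thesis by (rule mult_left_mono) simp
  qed
  also have "4 * w = 16 * t\<^sup>2 / s\<^sup>2" by (simp add: w_def)
  finally show ?thesis .
qed

text \<open>A step along axis \<open>i\<close> changes the squared distance by
  \<open>1 + 2 * z i\<close> or \<open>1 - 2 * z i\<close>, so the shift 28 turns into 29 around a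
  centre whose own value is \<open>1 / (s - 1)\<^sup>2\<close>. The margin \<open>1 / s ^ 3\<close>
  is kept to pay for the near field.\<close>

lemma far_supersolution:
  fixes z :: "nat \<Rightarrow> int"
  assumes d: "16 \<le> d"
  defines "s \<equiv> 29 + real_of_int (sqd d z)"
  shows "(\<Sum>i<d. 1 / (s + 2 * real_of_int (z i))\<^sup>2 + 1 / (s - 2 * real_of_int (z i))\<^sup>2) / (2 * real d)
    \<le> 1 / (s - 1)\<^sup>2 - 1 / s ^ 3"
proof -
  have s: "29 \<le> s" using sqd_nonneg[of d z] by (simp add: s_def)
  have "(\<Sum>i<d. 1 / (s + 2 * real_of_int (z i))\<^sup>2 + 1 / (s - 2 * real_of_int (z i))\<^sup>2)
     \<le> (\<Sum>i<d. 2 / s\<^sup>2 * (1 + 16 * (real_of_int (z i))\<^sup>2 / s\<^sup>2))"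
  proof (intro sum_mono far_term s)
    fix i assume "i \<in> {..<d}"
    hence "(z i)\<^sup>2 \<le> sqd d z" by (intro sqd_ge_coord) auto
    hence "real_of_int ((z i)\<^sup>2) \<le> real_of_int (sqd d z)" by (simp only: of_int_le_iff)
    thus "(real_of_int (z i))\<^sup>2 \<le> s" unfolding s_def of_int_power by linarith
  qed
  also have "\<dots> = 2 / s\<^sup>2 * (real d + 16 / s\<^sup>2 * (\<Sum>i<d. (real_of_int (z i))\<^sup>2))"
  proof -
    have "2 / s\<^sup>2 * (1 + 16 * t / s\<^sup>2) = 2 / s\<^sup>2 + 2 / s\<^sup>2 * (16 / s\<^sup>2) * t" for t
      by (simp add: algebra_simps)
    thus ?thesis by (simp only: sum.distrib flip: sum_distrib_left) (simp add: algebra_simps)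
  qed
  also have "(\<Sum>i<d. (real_of_int (z i))\<^sup>2) = s - 29"
    by (simp add: s_def sqd_def)
  \<comment> \<open>Here \<open>16 \<le> d\<close> enters: the second-order term is at most
    \<open>16 / s\<close>, hence at most \<open>d / s\<close>.\<close>
  also have "2 / s\<^sup>2 * (real d + 16 / s\<^sup>2 * (s - 29)) \<le> 2 / s\<^sup>2 * (real d + real d / s)"
  proof -
    have "16 / s\<^sup>2 * (s - 29) \<le> 16 / s\<^sup>2 * s" using s by (intro mult_left_mono) auto
    also have "\<dots> = 16 / s" using s by (simp add: power2_eq_square)
    also have "\<dots> \<le> real d / s" using s d by (intro divide_right_mono) auto
    finally show ?thesis using s by (intro mult_left_mono add_left_mono) auto
  qed
  finally have "(\<Sum>i<d. 1 / (s + 2 * real_of_int (z i))\<^sup>2 + 1 / (s - 2 * real_of_int (z i))\<^sup>2) / (2 * real d)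
     \<le> 2 / s\<^sup>2 * (real d + real d / s) / (2 * real d)"
    by (intro divide_right_mono) auto
  also have "\<dots> = 1 / s\<^sup>2 + 1 / s ^ 3"
    using d s by (simp add: field_simps power2_eq_square power3_eq_cube)
  also have "\<dots> \<le> 1 / (s - 1)\<^sup>2 - 1 / s ^ 3"
  proof -
    have "(s + 2) * (s - 1)\<^sup>2 \<le> s ^ 3"
      using s by (simp add: algebra_simps power2_eq_square power3_eq_cube)
    hence "(s + 2) / s ^ 3 \<le> 1 / (s - 1)\<^sup>2"
      using s by (simp add: divide_le_eq field_simps)
    moreover have "(s + 2) / s ^ 3 = 1 / s\<^sup>2 + 2 / s ^ 3"
      using s by (simp add: field_simps power2_eq_square power3_eq_cube)
    ultimately show ?thesis by simp
  qed
  finally show ?thesis .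
qed

text \<open>By integrality no step reaches the pole, and one reaches squared distance one only if
  \<open>u = 2 * \<bar>t\<bar>\<close>, which forces \<open>u \<le> 4\<close>. The bound is stated
  with \<open>t\<^sup>2\<close> so that summing over the axes gives back \<open>u\<close>.\<close>

lemma near_term:
  fixes t u :: int
  assumes "t\<^sup>2 \<le> u" "2 \<le> u" "0 < d"
  shows "near d (u + 1 + 2 * t) + near d (u + 1 - 2 * t) \<le> (if u \<le> 4 then real_of_int (t\<^sup>2) / real d else 0)"
proof -
  have a: "2 * \<bar>t\<bar> < u + 1"
  proof (rule ccontr)
    assume neg: "\<not> ?thesis"
    hence "(\<bar>t\<bar> - 1)\<^sup>2 \<le> 0" using assms by (simp add: power2_diff)
    hence "\<bar>t\<bar> = 1" by simp
    thus False using neg assms by auto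
  qed
  have b: "u = 2 * \<bar>t\<bar> \<Longrightarrow> u \<le> 4"
  proof -
    assume u: "u = 2 * \<bar>t\<bar>"
    have "\<bar>t\<bar> * \<bar>t\<bar> \<le> 2 * \<bar>t\<bar>" using assms(1) u by (simp add: power2_eq_square)
    moreover have "0 < \<bar>t\<bar>" using u assms(2) by simp
    ultimately have "\<bar>t\<bar> \<le> 2" by (simp only: mult_le_cancel_right_pos)
    thus ?thesis using u by simp
  qed
  show ?thesis
  proof (cases "u = 2 * \<bar>t\<bar>")
    case True
    have "t \<noteq> 0" using True assms by auto
    hence "1 \<le> t\<^sup>2" by (simp add: int_one_le_iff_zero_less)
    hence "1 / real d \<le> real_of_int (t\<^sup>2) / real d" by (intro divide_right_mono) linarith+
    thus ?thesis using True b[OF True] a \<open>t \<noteq> 0\<close>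
      by (auto simp: near_def abs_if split: if_splits)
  next
    case False
    hence "near d (u + 1 + 2 * t) = 0" "near d (u + 1 - 2 * t) = 0" using a by (auto simp: near_def)
    thus ?thesis by simp
  qed
qed

text \<open>The only defect arises for \<open>2 \<le> u \<le> 4\<close>, where the neighbour average
  is at most \<open>(u / d) / (2 * d)\<close>.\<close>

lemma near_supersolution:
  fixes z :: "nat \<Rightarrow> int"
  assumes d: "16 \<le> d"
  defines "u \<equiv> sqd d z"
  shows "(if u = 0 then 1 else 0) + (\<Sum>i<d. near d (u + 1 + 2 * z i) + near d (u + 1 - 2 * z i)) / (2 * real d)
    \<le> near d u + (if u \<le> 4 then 2 / (real d)\<^sup>2 else 0)"
proof -
  have zu: "(z i)\<^sup>2 \<le> u" if "i < d" for i using sqd_ge_coord[OF that] by (simp add: u_def)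
  have "0 \<le> u" by (simp add: u_def sqd_nonneg)
  then consider "u = 0" | "u = 1" | "2 \<le> u" by linarith
  thus ?thesis
  proof cases
    case 1
    hence "z i = 0" if "i < d" for i using zu[OF that] by simp
    hence "(\<Sum>i<d. near d (u + 1 + 2 * z i) + near d (u + 1 - 2 * z i)) = (\<Sum>i<d. 2 / real d)"
      using 1 by (intro sum.cong) (auto simp: near_def)
    also have "\<dots> = 2" using d by simp
    finally have "(\<Sum>i<d. near d (u + 1 + 2 * z i) + near d (u + 1 - 2 * z i)) / (2 * real d) = 1 / real d"
      by simp
    moreover have "1 / real d \<le> 1 + 2 / (real d)\<^sup>2" using d by (intro add_increasing2) auto
    moreover have "near d u = 2" using 1 by (simp add: near_def)
    ultimately show ?thesis using 1 by (simp only: if_True order_refl) simp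
  next
    case 2
    have "near d (u + 1 + 2 * z i) + near d (u + 1 - 2 * z i) \<le> 2 * real_of_int ((z i)\<^sup>2)" if "i < d" for i
    proof -
      have "(z i)\<^sup>2 \<le> 1\<^sup>2" using zu[OF that] 2 by simp
      hence "\<bar>z i\<bar> \<le> 1" by (metis abs_le_square_iff abs_one)
      then consider "z i = 0" | "z i = 1" | "z i = -1" by linarith
      thus ?thesis using 2 by cases (auto simp: near_def)
    qed
    hence "(\<Sum>i<d. near d (u + 1 + 2 * z i) + near d (u + 1 - 2 * z i)) \<le> (\<Sum>i<d. 2 * real_of_int ((z i)\<^sup>2))"
      by (intro sum_mono) auto
    also have "\<dots> = 2 * real_of_int u" by (simp add: u_def sqd_def sum_distrib_left)
    finally have "(\<Sum>i<d. near d (u + 1 + 2 * z i) + near d (u + 1 - 2 * z i)) / (2 * real d) \<le> 2 / (2 * real d)"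
      using 2 by (intro divide_right_mono) auto
    thus ?thesis using 2 by (auto simp: near_def intro: order_trans)
  next
    case 3
    have "(\<Sum>i<d. near d (u + 1 + 2 * z i) + near d (u + 1 - 2 * z i))
       \<le> (\<Sum>i<d. if u \<le> 4 then real_of_int ((z i)\<^sup>2) / real d else 0)"
      using 3 zu d by (intro sum_mono near_term) auto
    also have "\<dots> = (if u \<le> 4 then real_of_int u / real d else 0)"
      by (simp add: u_def sqd_def sum_divide_distrib)
    also have "\<dots> \<le> (if u \<le> 4 then 4 / real d else 0)"
      by (auto intro!: divide_right_mono)
    finally have "(\<Sum>i<d. near d (u + 1 + 2 * z i) + near d (u + 1 - 2 * z i)) / (2 * real d)
        \<le> (if u \<le> 4 then 4 / real d else 0) / (2 * real d)"
      using d by (intro divide_right_mono) auto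
    also have "\<dots> = (if u \<le> 4 then 2 / (real d)\<^sup>2 else 0)"
      by (simp add: power2_eq_square)
    finally show ?thesis using 3 by (simp add: near_def)
  qed
qed

lemma gmaj_supersolution:
  fixes z :: "nat \<Rightarrow> int"
  assumes d: "16 \<le> d"
  defines "u \<equiv> sqd d z"
  shows "(if u = 0 then 1 else 0) + (\<Sum>i<d. gmaj d (u + 1 + 2 * z i) + gmaj d (u + 1 - 2 * z i)) / (2 * real d)
    \<le> gmaj d u"
proof -
  define c where "c = cgap / (real d)\<^sup>2"
  define s where "s = 29 + real_of_int u"
  have u0: "0 \<le> u" by (simp add: u_def sqd_nonneg)
  have s: "29 \<le> s" using u0 by (simp add: s_def)
  have eq: "gmaj d (u + 1 + 2 * z i) + gmaj d (u + 1 - 2 * z i) =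
     (near d (u + 1 + 2 * z i) + near d (u + 1 - 2 * z i)) +
     c * (1 / (s + 2 * real_of_int (z i))\<^sup>2 + 1 / (s - 2 * real_of_int (z i))\<^sup>2)" for i
    by (simp add: gmaj_def c_def s_def algebra_simps)
  have "(\<Sum>i<d. gmaj d (u + 1 + 2 * z i) + gmaj d (u + 1 - 2 * z i)) / (2 * real d) =
     (\<Sum>i<d. near d (u + 1 + 2 * z i) + near d (u + 1 - 2 * z i)) / (2 * real d) +
     c * ((\<Sum>i<d. 1 / (s + 2 * real_of_int (z i))\<^sup>2 + 1 / (s - 2 * real_of_int (z i))\<^sup>2) / (2 * real d))"
    unfolding eq by (subst sum.distrib) (simp add: sum_distrib_left add_divide_distrib)
  moreover have "c * ((\<Sum>i<d. 1 / (s + 2 * real_of_int (z i))\<^sup>2 + 1 / (s - 2 * real_of_int (z i))\<^sup>2) / (2 * real d))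
      \<le> c * (1 / (s - 1)\<^sup>2 - 1 / s ^ 3)"
    using far_supersolution[OF d, of z] by (intro mult_left_mono) (auto simp: s_def u_def c_def cgap_def)
  moreover have "(if u \<le> 4 then 2 / (real d)\<^sup>2 else 0) \<le> c * (1 / s ^ 3)"
  proof (cases "u \<le> 4")
    case True
    hence "s ^ 3 \<le> 33 ^ 3" using s by (intro power_mono) (auto simp: s_def)
    hence "1 \<le> 33 ^ 3 / s ^ 3" using s by simp
    hence "2 / (real d)\<^sup>2 * 1 \<le> 2 / (real d)\<^sup>2 * (33 ^ 3 / s ^ 3)" by (intro mult_left_mono) auto
    thus ?thesis using True by (simp add: c_def cgap_def)
  next
    case False
    thus ?thesis using s by (simp add: c_def cgap_def)
  qed
  moreover have "gmaj d u = near d u + c * (1 / (s - 1)\<^sup>2)"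
    by (simp add: gmaj_def c_def s_def)
  ultimately show ?thesis
    using near_supersolution[OF d, of z] by (simp add: u_def algebra_simps)
qed

section \<open>Comparison of the Green function with the supersolution\<close>

lemma srw_prob_nonneg: "0 \<le> srw_prob d n x y"
  by (induction n arbitrary: x) (auto intro!: divide_nonneg_nonneg sum_nonneg)

text \<open>First-step decomposition: a longer partial sum is the source term plus the neighbour
  average of shorter ones, which the supersolution dominates. The bound does not depend on
  \<open>N\<close>, so it also yields convergence of the series, that is, transience.\<close>

lemma srw_prob_partial_le:
  assumes d: "16 \<le> d"
  shows "(\<Sum>n<N. srw_prob d n x y) \<le> gmaj d (sqd d (\<lambda>j. x j - y j))"
proof (induction N arbitrary: x)
  case 0
  have "0 \<le> gmaj d u" if "0 \<le> u" for u
    using that by (auto simp: gmaj_def near_def cgap_def)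
  thus ?case by (simp add: sqd_nonneg)
next
  case (Suc N)
  let ?u = "sqd d (\<lambda>j. x j - y j)"
  have "(\<Sum>n<Suc N. srw_prob d n x y) = srw_prob d 0 x y + (\<Sum>n<N. srw_prob d (Suc n) x y)"
    by (rule sum.lessThan_Suc_shift)
  moreover have "(\<Sum>n<N. srw_prob d (Suc n) x y) =
     (\<Sum>i<d. (\<Sum>n<N. srw_prob d n (\<lambda>j. x j + unit_vec i j) y) + (\<Sum>n<N. srw_prob d n (\<lambda>j. x j - unit_vec i j) y)) / (2 * real d)"
    unfolding srw_prob.simps sum_divide_distrib[symmetric] sum.distrib sum.swap[of _ "{..<d}" "{..<N}"] ..
  moreover have "(\<Sum>i<d. (\<Sum>n<N. srw_prob d n (\<lambda>j. x j + unit_vec i j) y) + (\<Sum>n<N. srw_prob d n (\<lambda>j. x j - unit_vec i j) y)) / (2 * real d)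
    \<le> (\<Sum>i<d. gmaj d (?u + 1 + 2 * (x i - y i)) + gmaj d (?u + 1 - 2 * (x i - y i))) / (2 * real d)"
  proof (intro divide_right_mono sum_mono add_mono)
    fix i assume "i \<in> {..<d}"
    hence "sqd d (\<lambda>j. x j + unit_vec i j - y j) = ?u + 1 + 2 * (x i - y i)"
        "sqd d (\<lambda>j. x j - unit_vec i j - y j) = ?u + 1 - 2 * (x i - y i)"
      using sqd_shift[of i d 1 x y] sqd_shift[of i d "-1" x y] by simp_all
    thus "(\<Sum>n<N. srw_prob d n (\<lambda>j. x j + unit_vec i j) y) \<le> gmaj d (?u + 1 + 2 * (x i - y i))"
      "(\<Sum>n<N. srw_prob d n (\<lambda>j. x j - unit_vec i j) y) \<le> gmaj d (?u + 1 - 2 * (x i - y i))"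
      using Suc[of "\<lambda>j. x j + unit_vec i j"] Suc[of "\<lambda>j. x j - unit_vec i j"] by (simp_all only:)
  qed simp
  moreover have "srw_prob d 0 x y \<le> (if ?u = 0 then 1 else 0)"
    by (simp add: sqd_def)
  ultimately show ?case
    using gmaj_supersolution[OF d, of "\<lambda>j. x j - y j"] by linarith
qed

lemma srw_prob_summable: "16 \<le> d \<Longrightarrow> summable (\<lambda>n. srw_prob d n x y)"
  by (rule summableI_nonneg_bounded[OF srw_prob_nonneg srw_prob_partial_le])

lemma green_le: "16 \<le> d \<Longrightarrow> green d x y \<le> gmaj d (sqd d (\<lambda>j. x j - y j))"
  unfolding green_def by (intro suminf_le_const srw_prob_summable srw_prob_partial_le)

lemma green_nonneg: "16 \<le> d \<Longrightarrow> 0 \<le> green d x y"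
  unfolding green_def by (intro suminf_nonneg srw_prob_summable srw_prob_nonneg)

lemma srw_prob_translate: "srw_prob d n x y = srw_prob d n (\<lambda>j. x j - y j) (\<lambda>_. 0)"
proof (induction n arbitrary: x)
  case 0
  have "x = y \<longleftrightarrow> (\<lambda>j. x j - y j) = (\<lambda>_. 0)" by (auto simp: fun_eq_iff)
  thus ?case by simp
next
  case (Suc n)
  have "(\<lambda>j. x j + unit_vec i j - y j) = (\<lambda>j. x j - y j + unit_vec i j)"
       "(\<lambda>j. x j - unit_vec i j - y j) = (\<lambda>j. x j - y j - unit_vec i j)" for i
    by auto
  hence "srw_prob d n (\<lambda>j. x j + unit_vec i j) y = srw_prob d n (\<lambda>j. x j - y j + unit_vec i j) (\<lambda>_. 0)"
     "srw_prob d n (\<lambda>j. x j - unit_vec i j) y = srw_prob d n (\<lambda>j. x j - y j - unit_vec i j) (\<lambda>_. 0)" for i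
    using Suc[of "\<lambda>j. x j + unit_vec i j"] Suc[of "\<lambda>j. x j - unit_vec i j"] by simp_all
  thus ?case by (simp only: srw_prob.simps)
qed

lemma green_diag: "green d x x = green0 d"
  by (simp add: green_def green0_def srw_prob_translate[of d _ x x])

lemma green0_ge_1: "16 \<le> d \<Longrightarrow> 1 \<le> green0 d"
  using sum_le_suminf[OF srw_prob_summable, of d "{0}" "\<lambda>_. 0" "\<lambda>_. 0"] srw_prob_nonneg
  by (simp add: green0_def green_def)

subsection \<open>Gaussian tails\<close>

text \<open>Exponential tilting: right of \<open>a\<close> the standard density is at most
  \<open>exp (- a\<^sup>2 / 2)\<close> times the density centred at \<open>a\<close>, which has
  total mass 1.\<close>

lemma std_normal_tail:
  assumes a: "0 \<le> a"
  shows "measure std_normal_distribution {a..} \<le> exp (- a\<^sup>2 / 2)"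
proof -
  have "emeasure std_normal_distribution {a..} = (\<integral>\<^sup>+x. ennreal (normal_density 0 1 x) * indicator {a..} x \<partial>lborel)"
    by (subst emeasure_density) auto
  also have "\<dots> \<le> (\<integral>\<^sup>+x. ennreal (exp (- a\<^sup>2 / 2)) * ennreal (normal_density a 1 x) \<partial>lborel)"
  proof (intro nn_integral_mono)
    fix x :: real
    have "normal_density 0 1 x \<le> exp (- a\<^sup>2 / 2) * normal_density a 1 x" if "a \<le> x"
    proof -
      have "0 \<le> a * (x - a)" using a that by simp
      hence "- x\<^sup>2 / 2 \<le> - a\<^sup>2 / 2 + - (x - a)\<^sup>2 / 2" by (simp add: power2_eq_square algebra_simps)
      hence "exp (- x\<^sup>2 / 2) \<le> exp (- a\<^sup>2 / 2) * exp (- (x - a)\<^sup>2 / 2)"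
        by (simp flip: exp_add)
      thus ?thesis by (simp add: normal_density_def divide_right_mono)
    qed
    thus "ennreal (normal_density 0 1 x) * indicator {a..} x \<le> ennreal (exp (- a\<^sup>2 / 2)) * ennreal (normal_density a 1 x)"
      by (auto simp: indicator_def ennreal_mult' [symmetric] intro!: ennreal_leI)
  qed
  also have "\<dots> = ennreal (exp (- a\<^sup>2 / 2)) * emeasure (density lborel (normal_density a 1)) UNIV"
    by (subst emeasure_density) (auto simp: nn_integral_cmult)
  also have "emeasure (density lborel (normal_density a 1)) UNIV = 1"
    using prob_space.emeasure_space_1[OF prob_space_normal_density[of 1 a]] by simp
  finally have "emeasure std_normal_distribution {a..} \<le> ennreal (exp (- a\<^sup>2 / 2))" by simp
  thus ?thesis unfolding measure_def by (intro enn2real_leI) auto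
qed

text \<open>Variance of the sum of the field over \<open>A\<close>.\<close>

definition gvar :: "nat \<Rightarrow> (nat \<Rightarrow> int) set \<Rightarrow> real" where
  "gvar d A = (\<Sum>x\<in>A. \<Sum>y\<in>A. green d x y)"

lemma gvar_pos:
  assumes "16 \<le> d" "finite A" "A \<noteq> {}"
  shows "0 < gvar d A"
proof -
  obtain x where x: "x \<in> A" using assms by auto
  have "1 \<le> green d x x" using green0_ge_1[OF assms(1)] by (simp add: green_diag)
  also have "\<dots> \<le> (\<Sum>y\<in>A. green d x y)"
    using x assms by (intro member_le_sum) (auto intro: green_nonneg)
  also have "\<dots> \<le> gvar d A"
    unfolding gvar_def using x assms
    by (intro member_le_sum) (auto intro!: sum_nonneg green_nonneg)
  finally show ?thesis by simp
qed

text \<open>On this event the sum of \<open>s * phi x\<close> over \<open>A\<close>, a single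
  centered Gaussian, is at least \<open>h * card A\<close>. The sign \<open>s\<close> lets the same
  bound serve high levels and, with -1, the Peierls argument at low levels.\<close>

lemma GFF_all_ge_le:
  assumes G: "is_GFF d M phi" and d: "16 \<le> d" and A: "finite A" "A \<noteq> {}" "A \<subseteq> lattice d"
    and s: "s = 1 \<or> s = -1" and h: "0 \<le> h" and V: "gvar d A \<le> V"
  shows "measure M {\<omega> \<in> space M. \<forall>x\<in>A. h \<le> s * phi x \<omega>} \<le> exp (- (h * card A)\<^sup>2 / (2 * V))"
proof -
  interpret prob_space M using G by (simp add: is_GFF_def)
  define v where "v = gvar d A"
  have v: "0 < v" unfolding v_def by (rule gvar_pos[OF d A(1,2)])
  define c where "c = s / sqrt v"
  define Y where "Y = (\<lambda>\<omega>. \<Sum>x\<in>A. c * phi x \<omega>)"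
  have meas: "phi x \<in> borel_measurable M" if "x \<in> A" for x
    using G A that by (auto simp: is_GFF_def)
  have Ym: "Y \<in> borel_measurable M"
    unfolding Y_def by (intro borel_measurable_sum borel_measurable_times meas) auto
  have "(\<Sum>x\<in>A. \<Sum>y\<in>A. c * c * green d x y) = c * c * v"
    by (simp add: v_def gvar_def sum_distrib_left)
  also have "\<dots> = 1" using v s by (auto simp: c_def)
  finally have var: "(\<Sum>x\<in>A. \<Sum>y\<in>A. c * c * green d x y) = 1" .
  have "char (distr M borel Y) t = char std_normal_distribution t" for t
    using G A unfolding is_GFF_def Y_def
    by (auto dest!: spec[of _ A] spec[of _ "\<lambda>_. c"] simp: var char_std_normal_distribution)
  hence law: "distr M borel Y = std_normal_distribution"
    by (intro Levy_uniqueness real_distribution_distr real_dist_normal_dist Ym ext)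
  define a where "a = h * card A / sqrt v"
  have a: "0 \<le> a" using h v by (simp add: a_def)
  have "measure M {\<omega> \<in> space M. \<forall>x\<in>A. h \<le> s * phi x \<omega>} \<le> measure M (Y -` {a..} \<inter> space M)"
  proof (rule finite_measure_mono)
    show "{\<omega> \<in> space M. \<forall>x\<in>A. h \<le> s * phi x \<omega>} \<subseteq> Y -` {a..} \<inter> space M"
    proof safe
      fix \<omega> assume *: "\<forall>x\<in>A. h \<le> s * phi x \<omega>"
      have "h * card A = (\<Sum>x\<in>A. h)" by simp
      also have "\<dots> \<le> (\<Sum>x\<in>A. s * phi x \<omega>)" using * by (intro sum_mono) auto
      finally have "a \<le> (\<Sum>x\<in>A. s * phi x \<omega>) / sqrt v"
        unfolding a_def using v by (intro divide_right_mono) auto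
      also have "\<dots> = Y \<omega>" by (simp add: Y_def c_def sum_divide_distrib)
      finally show "\<omega> \<in> Y -` {a..}" by simp
    qed
    show "Y -` {a..} \<inter> space M \<in> sets M" using Ym by measurable
  qed
  also have "\<dots> = measure (distr M borel Y) {a..}"
    using Ym by (simp add: measure_distr)
  also have "\<dots> \<le> exp (- a\<^sup>2 / 2)" unfolding law by (rule std_normal_tail[OF a])
  also have "\<dots> = exp (- (h * card A)\<^sup>2 / (2 * v))"
    using v by (simp add: a_def power_divide)
  also have "\<dots> \<le> exp (- (h * card A)\<^sup>2 / (2 * V))"
    using v V by (auto simp: v_def intro!: divide_left_mono mult_pos_pos)
  finally show ?thesis .
qed

subsection \<open>Chordless lattice paths\<close>

lemma successively_take: "successively P xs \<Longrightarrow> successively P (take n xs)"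
  by (metis append_take_drop_id successively_append_iff)

lemma successively_drop: "successively P xs \<Longrightarrow> successively P (drop n xs)"
  by (metis append_take_drop_id successively_append_iff)

lemma successively_nth: "successively P xs \<Longrightarrow> Suc i < length xs \<Longrightarrow> P (xs ! i) (xs ! Suc i)"
  by (induction xs arbitrary: i rule: induct_list012) (auto simp: nth_Cons split: nat.splits)

lemma successively_nthI: "(\<And>i. Suc i < length xs \<Longrightarrow> P (xs ! i) (xs ! Suc i)) \<Longrightarrow> successively P xs"
proof (induction xs rule: induct_list012)
  case (3 x y zs)
  have "P x y" using "3.prems"[of 0] by simp
  moreover have "successively P (y # zs)" using "3.prems"[of "Suc _"] by (intro "3.IH") auto
  ultimately show ?case by simp
qed auto

lemma nn_sym: "nn d x y \<Longrightarrow> nn d y x"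
  by (simp add: nn_def abs_minus_commute)

lemma nn_coord: "nn d x y \<Longrightarrow> i < d \<Longrightarrow> \<bar>x i - y i\<bar> \<le> 1"
  using member_le_sum[of i "{..<d}" "\<lambda>i. \<bar>x i - y i\<bar>"] by (auto simp: nn_def)

lemma nn_irrefl: "\<not> nn d x x"
  by (simp add: nn_def)

lemma nn_shift:
  assumes "nn d x y"
  shows "\<exists>i<d. \<exists>s\<in>{1,-1}. y = (\<lambda>j. x j + s * unit_vec i j)"
proof -
  have lat: "x \<in> lattice d" "y \<in> lattice d" and S: "(\<Sum>i<d. \<bar>x i - y i\<bar>) = 1"
    using assms by (auto simp: nn_def)
  obtain i where i: "i < d" "x i \<noteq> y i"
  proof (rule ccontr)
    assume "\<not> thesis"
    hence "(\<Sum>i<d. \<bar>x i - y i\<bar>) = 0" using that by (intro sum.neutral) auto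
    thus False using S by simp
  qed
  have S': "\<bar>x i - y i\<bar> + (\<Sum>j\<in>{..<d}-{i}. \<bar>x j - y j\<bar>) = 1"
    using S i by (subst (asm) sum.remove[of _ i]) auto
  have nonneg: "0 \<le> (\<Sum>j\<in>{..<d}-{i}. \<bar>x j - y j\<bar>)" by (intro sum_nonneg) auto
  have zero: "(\<Sum>j\<in>{..<d}-{i}. \<bar>x j - y j\<bar>) = 0" and one: "\<bar>x i - y i\<bar> = 1"
    using S' nonneg i(2) by linarith+
  have rest: "x j = y j" if "j \<noteq> i" for j
  proof (cases "j < d")
    case True
    have "\<forall>j\<in>{..<d}-{i}. \<bar>x j - y j\<bar> = 0"
      using zero by (subst (asm) sum_nonneg_eq_0_iff) auto
    thus ?thesis using True that by auto
  next
    case False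
    thus ?thesis using lat by (auto simp: lattice_def)
  qed
  have "y = (\<lambda>j. x j + (y i - x i) * unit_vec i j)"
    using rest by (auto simp: unit_vec_def)
  moreover have "y i - x i \<in> {1, -1}" using one by auto
  ultimately show ?thesis using i(1) by blast
qed

lemma nn_if_sqd_eq_1:
  assumes "x \<in> lattice d" "y \<in> lattice d" "sqd d (\<lambda>j. x j - y j) = 1"
  shows "nn d x y"
proof -
  have "\<bar>x i - y i\<bar> = (x i - y i)\<^sup>2" if "i < d" for i
  proof -
    have "(x i - y i)\<^sup>2 \<le> 1\<^sup>2" using sqd_ge_coord[OF that, of "\<lambda>j. x j - y j"] assms(3) by simp
    hence "\<bar>x i - y i\<bar> \<le> 1" by (metis abs_le_square_iff abs_one)
    then consider "x i - y i = 0" | "x i - y i = 1" | "x i - y i = -1" by linarith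
    thus ?thesis by cases auto
  qed
  hence "(\<Sum>i<d. \<bar>x i - y i\<bar>) = sqd d (\<lambda>j. x j - y j)" by (simp add: sqd_def)
  thus ?thesis using assms by (simp add: nn_def)
qed

text \<open>\<open>n\<close> counts steps, so the lists have one vertex more. The relation is a
  parameter because lattice paths and planar 8-neighbour paths are both counted.\<close>

definition walks :: "('b \<Rightarrow> 'b \<Rightarrow> bool) \<Rightarrow> nat \<Rightarrow> 'b \<Rightarrow> 'b list set" where
  "walks R n x = {p. length p = Suc n \<and> hd p = x \<and> successively R p}"

lemma walks_Suc: "walks R (Suc n) x = (\<Union>y\<in>{y. R x y}. (#) x ` walks R n y)"
proof -
  have "p \<in> (\<Union>y\<in>{y. R x y}. (#) x ` walks R n y)" if p: "p \<in> walks R (Suc n) x" for p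
  proof -
    obtain y q where "p = x # y # q" using p by (cases p; cases "tl p") (auto simp: walks_def)
    thus ?thesis using p by (auto simp: walks_def)
  qed
  moreover have "x # q \<in> walks R (Suc n) x" if "R x y" "q \<in> walks R n y" for y q
    using that by (cases q) (auto simp: walks_def)
  ultimately show ?thesis by blast
qed

lemma walks_card:
  assumes "\<And>x. finite {y. R x y}" "\<And>x. card {y. R x y} \<le> D"
  shows "finite (walks R n x) \<and> card (walks R n x) \<le> D ^ n"
proof (induction n arbitrary: x)
  case 0
  have "walks R 0 x = {[x]}" by (auto simp: walks_def length_Suc_conv)
  thus ?case by simp
next
  case (Suc n)
  have "card (walks R (Suc n) x) \<le> (\<Sum>y\<in>{y. R x y}. card ((#) x ` walks R n y))"
    unfolding walks_Suc by (rule card_UN_le[OF assms(1)])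
  also have "\<dots> \<le> (\<Sum>y\<in>{y. R x y}. D ^ n)"
    by (intro sum_mono order_trans[OF card_image_le]) (use Suc in auto)
  also have "\<dots> \<le> D ^ Suc n" using assms(2)[of x] by simp
  finally show ?case unfolding walks_Suc using assms(1) Suc by auto
qed

lemma nn_card: "finite {y. nn d x y}" "card {y. nn d x y} \<le> 2 * d"
proof -
  let ?f = "\<lambda>(i,s::int). (\<lambda>j. x j + s * unit_vec i j)"
  have sub: "{y. nn d x y} \<subseteq> ?f ` ({..<d} \<times> {1,-1})" using nn_shift by force
  thus "finite {y. nn d x y}" by (rule finite_subset) auto
  have "card {y. nn d x y} \<le> card (?f ` ({..<d} \<times> {1,-1}))" using sub by (intro card_mono) auto
  also have "\<dots> \<le> card ({..<d} \<times> {1,-1::int})" by (rule card_image_le) auto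
  finally show "card {y. nn d x y} \<le> 2 * d" by (simp add: card_cartesian_product)
qed

definition cube :: "nat \<Rightarrow> (nat \<Rightarrow> int) \<Rightarrow> nat \<Rightarrow> (nat \<Rightarrow> int) set" where
  "cube d x r = {y \<in> lattice d. \<forall>i<d. \<bar>y i - x i\<bar> \<le> int r}"

definition far :: "nat \<Rightarrow> nat \<Rightarrow> (nat \<Rightarrow> int) \<Rightarrow> (nat \<Rightarrow> int) \<Rightarrow> bool" where
  "far d r x y \<longleftrightarrow> (\<exists>i<d. int r \<le> \<bar>y i - x i\<bar>)"

lemma far_sym: "far d r x y \<longleftrightarrow> far d r y x"
  by (simp add: far_def abs_minus_commute)

lemma far_mono: "far d r x y \<Longrightarrow> s \<le> r \<Longrightarrow> far d s x y"
  by (force simp: far_def)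

lemma cube_card: "finite (cube d x r)" "card (cube d x r) \<le> (2 * r + 1) ^ d"
proof -
  let ?P = "PiE {..<d} (\<lambda>i. {x i - int r..x i + int r})"
  let ?f = "\<lambda>y. restrict y {..<d}"
  have inj: "inj_on ?f (cube d x r)"
  proof (rule inj_onI, rule ext)
    fix y z i assume *: "y \<in> cube d x r" "z \<in> cube d x r" "?f y = ?f z"
    show "y i = z i"
    proof (cases "i < d")
      case True thus ?thesis using fun_cong[OF *(3), of i] by simp
    next
      case False thus ?thesis using * by (simp add: cube_def lattice_def)
    qed
  qed
  have sub: "?f ` cube d x r \<subseteq> ?P" by (auto simp: cube_def abs_le_iff split: if_splits)
  have fin: "finite ?P" by (intro finite_PiE) auto
  show "finite (cube d x r)" using inj_on_finite[OF inj sub fin] .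
  have "card (cube d x r) \<le> card ?P" by (rule card_inj_on_le[OF inj sub fin])
  also have "\<dots> = (\<Prod>i<d. 2 * r + 1)"
    by (subst card_PiE, simp, intro prod.cong refl) (simp add: nat_eq_iff)
  finally show "card (cube d x r) \<le> (2 * r + 1) ^ d" by simp
qed

text \<open>Induced path in the graph-theoretic sense. A vertex has at most two lattice neighbours
  on such a path, which limits the terms of order \<open>1 / d\<close> in the variance.\<close>

definition induced :: "nat \<Rightarrow> (nat \<Rightarrow> int) list \<Rightarrow> bool" where
  "induced d p \<longleftrightarrow> p \<noteq> [] \<and> set p \<subseteq> lattice d \<and> successively (nn d) p \<and> distinct p \<and>
     (\<forall>i j. Suc i < j \<and> j < length p \<longrightarrow> \<not> nn d (p ! i) (p ! j))"

lemma induced_take: "induced d p \<Longrightarrow> 0 < m \<Longrightarrow> induced d (take m p)"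
  by (auto simp: induced_def successively_take dest: in_set_takeD)

lemma induced_rev: "induced d p \<Longrightarrow> induced d (rev p)"
proof -
  assume p: "induced d p"
  have "successively (\<lambda>x y. nn d y x) p"
    using p by (auto simp: induced_def intro: successively_mono nn_sym)
  moreover have "\<not> nn d (rev p ! i) (rev p ! j)" if "Suc i < j" "j < length p" for i j
  proof
    assume "nn d (rev p ! i) (rev p ! j)"
    hence "nn d (p ! (length p - Suc j)) (p ! (length p - Suc i))"
      using that by (auto simp: rev_nth intro: nn_sym)
    moreover have "Suc (length p - Suc j) < length p - Suc i" "length p - Suc i < length p" using that by auto
    ultimately show False using p unfolding induced_def by blast
  qed
  ultimately show ?thesis using p by (auto simp: induced_def)
qed

lemma induced_nn_nth:
  assumes "induced d p" "i < length p" "j < length p" "nn d (p ! i) (p ! j)"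
  shows "j = Suc i \<or> i = Suc j"
proof -
  have "i \<noteq> j" using assms(4) nn_irrefl by auto
  moreover have "\<not> Suc i < j" using assms by (auto simp: induced_def)
  moreover have "\<not> Suc j < i" using assms nn_sym[OF assms(4)] unfolding induced_def by blast
  ultimately show ?thesis by linarith
qed

text \<open>A shortest path inside \<open>set p\<close> has no shortcut, hence is induced.\<close>

lemma ex_induced_subpath:
  assumes "p \<noteq> []" "set p \<subseteq> lattice d" "successively (nn d) p"
  shows "\<exists>q. induced d q \<and> hd q = hd p \<and> last q = last p \<and> set q \<subseteq> set p"
  using assms
proof (induction "length p" arbitrary: p rule: less_induct)
  case less
  show ?case
  proof (cases "induced d p")
    case True thus ?thesis by blast
  next
    case False
    obtain q where q: "length q < length p" "q \<noteq> []" "successively (nn d) q" "hd q = hd p" "last q = last p" "set q \<subseteq> set p"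
    proof (cases "distinct p")
      case False
      then obtain i j where ij: "i < j" "j < length p" "p ! i = p ! j"
        by (metis distinct_conv_nth linorder_neqE_nat)
      \<comment> \<open>The loop between two visits is cut out; the second visit is dropped because
        the first one is kept.\<close>
      let ?q = "take (Suc i) p @ drop (Suc j) p"
      have la: "last (take (Suc i) p) = p ! i" using ij by (simp add: take_Suc_conv_app_nth)
      have hdr: "drop (Suc j) p \<noteq> [] \<Longrightarrow> nn d (p ! j) (hd (drop (Suc j) p))"
        using successively_nth[OF less.prems(3), of j] by (simp add: hd_drop_conv_nth)
      have "drop (Suc j) p = [] \<Longrightarrow> last p = p ! j"
        using ij by (simp add: last_conv_nth) (metis Suc_leI diff_Suc_1 le_antisym less.prems(1) last_conv_nth)
      hence "last ?q = last p" using ij la by (cases "drop (Suc j) p = []") (auto simp: last_append last_drop)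
      moreover have "successively (nn d) ?q"
        using less.prems ij la hdr by (auto simp: successively_append_iff successively_take successively_drop)
      moreover have "hd ?q = hd p" using less.prems by (simp add: hd_append)
      ultimately show ?thesis using ij less.prems(1)
        by (intro that[of ?q]) (auto dest: in_set_takeD in_set_dropD)
    next
      case True
      then obtain i j where ij: "Suc i < j" "j < length p" "nn d (p ! i) (p ! j)"
        using False less.prems by (auto simp: induced_def)
      \<comment> \<open>The chord replaces the stretch between its ends; \<open>Suc i < j\<close>
        makes the result strictly shorter.\<close>
      let ?q = "take (Suc i) p @ drop j p"
      have la: "last (take (Suc i) p) = p ! i" using ij by (simp add: take_Suc_conv_app_nth)
      have "successively (nn d) ?q"
        using less.prems ij la by (auto simp: successively_append_iff successively_take successively_drop hd_drop_conv_nth)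
      moreover have "hd ?q = hd p" using less.prems by (simp add: hd_append)
      ultimately show ?thesis using ij less.prems(1)
        by (intro that[of ?q]) (auto dest: in_set_takeD in_set_dropD)
    qed
    show ?thesis using less.hyps[OF q(1,2) _ q(3)] q less.prems(2) by (metis order_trans)
  qed
qed

subsection \<open>Separated families of path pieces\<close>

text \<open>Each set in \<open>config d n k x\<close> consists of \<open>2 ^ k\<close> chordless paths with \<open>n\<close> vertices. A path that
  travels distance \<open>radius n (Suc k)\<close> contains one such set near its start and another near the
  first point \<open>z\<close> at that distance, found by following the path backwards from \<open>z\<close>.\<close>

abbreviation radius :: "nat \<Rightarrow> nat \<Rightarrow> nat" where
  "radius n k \<equiv> n * 5 ^ k"

fun config :: "nat \<Rightarrow> nat \<Rightarrow> nat \<Rightarrow> (nat \<Rightarrow> int) \<Rightarrow> (nat \<Rightarrow> int) set set" where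
  "config d n 0 x = {set p |p. induced d p \<and> length p = n \<and> hd p = x}"
| "config d n (Suc k) x =
     {A \<union> B |A B z. A \<in> config d n k x \<and> z \<in> cube d x (radius n (Suc k)) \<and>
        far d (radius n (Suc k)) x z \<and> B \<in> config d n k z}"

lemma walk_coord:
  assumes "successively (nn d) p" "i < d" "m < length p"
  shows "\<bar>(p ! m) i - hd p i\<bar> \<le> int m"
  using assms(3)
proof (induction m)
  case 0
  thus ?case by (simp add: hd_conv_nth)
next
  case (Suc m)
  have "\<bar>(p ! m) i - (p ! Suc m) i\<bar> \<le> 1"
    using nn_coord[OF successively_nth[OF assms(1)]] Suc.prems assms(2) by blast
  thus ?case using Suc by simp
qed

lemma path_contains_config:
  assumes "induced d p" "0 < n" "far d (radius n k) (hd p) (last p)"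
  shows "\<exists>A\<in>config d n k (hd p). A \<subseteq> set p"
  using assms
proof (induction k arbitrary: p)
  case 0
  obtain i where i: "i < d" "int n \<le> \<bar>last p i - hd p i\<bar>" using 0(3) by (auto simp: far_def)
  have p: "successively (nn d) p" "p \<noteq> []" using 0(1) by (auto simp: induced_def)
  have "n \<le> length p - 1"
    using walk_coord[OF p(1) i(1), of "length p - 1"] p i by (simp add: last_conv_nth)
  hence "length (take n p) = n" by simp
  moreover have "hd (take n p) = hd p" using 0(2) by simp
  moreover have "induced d (take n p)" using 0 by (intro induced_take)
  ultimately have "set (take n p) \<in> config d n 0 (hd p)" by auto
  thus ?case using set_take_subset by (rule rev_bexI)
next
  case (Suc k)
  define L where "L = radius n (Suc k)"
  have L: "0 < L" "radius n k \<le> L" using Suc.prems(2) by (auto simp: L_def)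
  have p: "successively (nn d) p" "p \<noteq> []" "set p \<subseteq> lattice d" using Suc.prems(1) by (auto simp: induced_def)
  define m where "m = (LEAST m. far d L (hd p) (p ! m))"
  have ex: "far d L (hd p) (p ! (length p - 1))"
    using Suc.prems(3) p by (simp add: last_conv_nth L_def)
  have far: "far d L (hd p) (p ! m)" unfolding m_def by (rule LeastI[of "\<lambda>m. far d L (hd p) (p ! m)", OF ex])
  have mlen: "m < length p" using Least_le[of "\<lambda>m. far d L (hd p) (p ! m)", OF ex] p(2) unfolding m_def[symmetric]
    by (cases p) auto
  \<comment> \<open>The predecessor is closer than \<open>L\<close> in every coordinate, and one
    step moves a coordinate by at most one.\<close>
  have cube: "p ! m \<in> cube d (hd p) L"
  proof -
    have "\<not> far d L (hd p) (hd p)" using L by (simp add: far_def)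
    hence "m \<noteq> 0" using far p by (metis hd_conv_nth)
    then obtain m' where m': "m = Suc m'" by (cases m) auto
    have nf: "\<not> far d L (hd p) (p ! m')" unfolding m_def
      by (rule not_less_Least) (use m' m_def in simp)
    have nb: "nn d (p ! m') (p ! m)" unfolding m' using successively_nth[OF p(1)] mlen m' by simp
    have "\<bar>(p ! m) i - hd p i\<bar> \<le> int L" if "i < d" for i
      using nf nn_coord[OF nb that] that by (auto simp: far_def not_le)
    thus ?thesis using p(3) mlen nth_mem by (auto simp: cube_def)
  qed
  define q where "q = take (Suc m) p"
  have q: "induced d q" "hd q = hd p" "set q \<subseteq> set p" "q \<noteq> []"
    using induced_take[OF Suc.prems(1)] mlen p(2)
    by (auto simp: q_def dest: in_set_takeD)
  have lastq: "last q = p ! m" using mlen by (simp add: q_def take_Suc_conv_app_nth)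
  obtain A where A: "A \<in> config d n k (hd p)" "A \<subseteq> set q"
    using Suc.IH[OF q(1) Suc.prems(2)] q lastq far_mono[OF far L(2)] by auto
  \<comment> \<open>The reversed prefix runs from \<open>p ! m\<close> back to the start of
    \<open>p\<close>, so the induction hypothesis applies to it as well.\<close>
  have "far d (radius n k) (hd (rev q)) (last (rev q))"
    using q lastq far_mono[OF far L(2)] by (simp add: hd_rev last_rev far_sym[of _ _ "p ! m"])
  then obtain B where B: "B \<in> config d n k (p ! m)" "B \<subseteq> set q"
    using Suc.IH[OF induced_rev[OF q(1)] Suc.prems(2)] q lastq by (auto simp: hd_rev)
  have "A \<union> B \<in> config d n (Suc k) (hd p)"
    unfolding config.simps
    by (intro CollectI exI[of _ A] exI[of _ B] exI[of _ "p ! m"] conjI refl)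
      (use A B far cube in \<open>simp_all add: L_def\<close>)
  moreover have "A \<union> B \<subseteq> set p" using A(2) B(2) q(3) by auto
  ultimately show ?case by (rule rev_bexI)
qed

text \<open>The factor \<open>(125 * radius n k) ^ d\<close> makes the induction go through: it absorbs the choice of
  \<open>z\<close> in the next step, whose logarithm grows linearly in \<open>k\<close> while the number of paths doubles.\<close>

lemma config_finite_card:
  assumes d: "0 < d" and n: "0 < n"
  shows "finite (config d n k x) \<and> card (config d n k x) * (125 * radius n k) ^ d \<le> ((125 * n) ^ d * (2 * d) ^ n) ^ 2 ^ k"
proof (induction k arbitrary: x)
  case 0
  obtain m where m: "n = Suc m" using n by (cases n) auto
  have w: "finite (walks (nn d) m x)" "card (walks (nn d) m x) \<le> (2 * d) ^ m"
    using walks_card[of "nn d" "2 * d"] nn_card by auto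
  have sub: "config d n 0 x \<subseteq> set ` walks (nn d) m x"
    by (auto simp: walks_def m induced_def)
  have "card (config d n 0 x) \<le> card (set ` walks (nn d) m x)" using sub w by (intro card_mono) auto
  also have "\<dots> \<le> (2 * d) ^ m" using card_image_le[OF w(1)] w(2) order_trans by blast
  also have "\<dots> \<le> (2 * d) ^ n" using d m by (intro power_increasing) auto
  finally have "card (config d n 0 x) * (125 * n) ^ d \<le> (2 * d) ^ n * (125 * n) ^ d" by (rule mult_le_mono1)
  thus ?case using finite_subset[OF sub] w by (simp add: mult.commute)
next
  case (Suc k)
  define U where "U = (125 * n) ^ d * (2 * d) ^ n"
  define Q where "Q = (125 * radius n k) ^ d"
  let ?Z = "cube d x (radius n (Suc k))"
  let ?C = "config d n k"
  let ?T = "Sigma ?Z (\<lambda>z. ?C x \<times> ?C z)"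
  have Q0: "0 < Q" using n by (simp add: Q_def)
  have IH: "finite (?C y)" "card (?C y) * Q \<le> U ^ 2 ^ k" for y
    using Suc[of y] unfolding U_def Q_def by blast+
  have sub: "config d n (Suc k) x \<subseteq> (\<lambda>(z,A,B). A \<union> B) ` ?T"
  proof
    fix S assume "S \<in> config d n (Suc k) x"
    then obtain A B z where "S = A \<union> B" "A \<in> ?C x" "z \<in> ?Z" "B \<in> ?C z"
      unfolding config.simps by blast
    thus "S \<in> (\<lambda>(z,A,B). A \<union> B) ` ?T" by (intro image_eqI[of _ _ "(z, A, B)"]) simp_all
  qed
  have fin: "finite ?T" using IH cube_card by (intro finite_SigmaI) auto
  have "card (config d n (Suc k) x) \<le> card ((\<lambda>(z,A,B). A \<union> B) ` ?T)"
    using sub fin by (intro card_mono) auto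
  also have "\<dots> \<le> card ?T" by (rule card_image_le[OF fin])
  also have "\<dots> = (\<Sum>z\<in>?Z. card (?C x) * card (?C z))"
    using IH cube_card by (subst card_SigmaI) (auto simp: card_cartesian_product)
  finally have "card (config d n (Suc k) x) * (Q * Q) \<le> (\<Sum>z\<in>?Z. card (?C x) * card (?C z)) * (Q * Q)"
    by (rule mult_le_mono1)
  also have "\<dots> = (\<Sum>z\<in>?Z. (card (?C x) * Q) * (card (?C z) * Q))"
    unfolding sum_distrib_right by (intro sum.cong refl) (simp only: mult_ac)
  also have "\<dots> \<le> (\<Sum>z\<in>?Z. U ^ 2 ^ k * U ^ 2 ^ k)"
    by (intro sum_mono mult_le_mono IH)
  also have "\<dots> = card ?Z * U ^ 2 ^ Suc k"
    by (simp flip: power_add add: mult_2)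
  also have "\<dots> \<le> (25 * radius n k) ^ d * U ^ 2 ^ Suc k"
  proof (rule mult_le_mono1)
    have "2 * radius n (Suc k) + 1 \<le> 25 * radius n k" using n by simp
    thus "card ?Z \<le> (25 * radius n k) ^ d"
      using cube_card(2)[of d x "radius n (Suc k)"] by (meson order_trans power_mono zero_le)
  qed
  finally have 1: "card (config d n (Suc k) x) * (Q * Q) \<le> (25 * radius n k) ^ d * U ^ 2 ^ Suc k" .
  \<comment> \<open>Since the radius grows by the factor 5 and 125 * 5 * 25 = 125 * 125, the two
    factors \<open>Q\<close> split exactly into the factor of the next level and the one paying for
    the choice of \<open>z\<close>.\<close>
  have QQ: "(125 * radius n (Suc k)) ^ d * (25 * radius n k) ^ d = Q * Q"
    unfolding Q_def power_mult_distrib[symmetric] by (rule arg_cong[where f = "\<lambda>t. t ^ d"]) simp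
  have "(25 * radius n k) ^ d * (card (config d n (Suc k) x) * (125 * radius n (Suc k)) ^ d)
      \<le> (25 * radius n k) ^ d * U ^ 2 ^ Suc k"
    using 1 unfolding QQ[symmetric] by (simp only: mult_ac)
  hence "card (config d n (Suc k) x) * (125 * radius n (Suc k)) ^ d \<le> U ^ 2 ^ Suc k"
    using n by simp
  moreover have "finite (config d n (Suc k) x)" using finite_subset[OF sub] fin by auto
  ultimately show ?case by (simp add: U_def)
qed

section \<open>Variance of the field summed over a configuration\<close>

lemma green_le_gap:
  assumes d: "16 \<le> d" and "x \<in> lattice d" "y \<in> lattice d" "x \<noteq> y"
  shows "green d x y \<le> (if nn d x y then 1 / real d else 0) + cgap / (real d)\<^sup>2"
proof -
  let ?u = "sqd d (\<lambda>j. x j - y j)"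
  have "?u \<noteq> 0"
  proof
    assume "?u = 0"
    hence "x i = y i" if "i < d" for i using sqd_ge_coord[OF that, of "\<lambda>j. x j - y j"] by simp
    hence "x = y" using assms by (auto simp: lattice_def fun_eq_iff) (metis not_le)
    thus False using assms by simp
  qed
  \<comment> \<open>The pole is excluded, so the near field survives only at squared distance one,
    where the points are neighbours.\<close>
  hence near: "near d ?u \<le> (if nn d x y then 1 / real d else 0)"
    using nn_if_sqd_eq_1[OF assms(2,3)] by (auto simp: near_def)
  have "cgap / (real d)\<^sup>2 / (28 + real_of_int ?u)\<^sup>2 \<le> cgap / (real d)\<^sup>2 / 1"
    using sqd_nonneg[of d "\<lambda>j. x j - y j"]
    by (intro divide_left_mono) (auto simp: cgap_def intro!: one_le_power)
  thus ?thesis using green_le[OF d, of x y] near by (simp add: gmaj_def cgap_def)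
qed

text \<open>Squared distance at least 4 kills the near field. Of the available decay only the
  inverse square of \<open>r\<close> is kept, which suffices because separations grow like
  \<open>5 ^ k\<close> and cardinalities only like \<open>2 ^ k\<close>.\<close>

lemma green_le_far:
  assumes d: "16 \<le> d" and r: "2 \<le> r" and "far d r x y"
  shows "green d x y \<le> cgap / (real d)\<^sup>2 / (real r)\<^sup>2"
proof -
  let ?u = "sqd d (\<lambda>j. x j - y j)"
  obtain i where i: "i < d" "int r \<le> \<bar>x i - y i\<bar>"
    using assms(3) by (auto simp: far_def abs_minus_commute)
  have "(int r)\<^sup>2 \<le> (x i - y i)\<^sup>2" using i(2) by (simp add: abs_le_square_iff[symmetric])
  also have "\<dots> \<le> ?u" using sqd_ge_coord[OF i(1), of "\<lambda>j. x j - y j"] .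
  finally have u: "(int r)\<^sup>2 \<le> ?u" .
  have "(2::int)\<^sup>2 \<le> (int r)\<^sup>2" using r by (intro power_mono) auto
  hence near: "near d ?u = 0" using u by (auto simp: near_def)
  have "real_of_int ((int r)\<^sup>2) \<le> real_of_int ?u" using u by (simp only: of_int_le_iff)
  hence u': "(real r)\<^sup>2 \<le> 28 + real_of_int ?u" by simp
  moreover have "1 \<le> 28 + real_of_int ?u" using sqd_nonneg[of d "\<lambda>j. x j - y j"] by simp
  ultimately have "(real r)\<^sup>2 * 1 \<le> (28 + real_of_int ?u) * (28 + real_of_int ?u)"
    by (intro mult_mono) auto
  hence "cgap / (real d)\<^sup>2 / (28 + real_of_int ?u)\<^sup>2 \<le> cgap / (real d)\<^sup>2 / (real r)\<^sup>2"
    using r \<open>1 \<le> 28 + _\<close> by (intro divide_left_mono mult_pos_pos) (auto simp: cgap_def power2_eq_square)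
  thus ?thesis using green_le[OF d, of x y] near by (simp add: gmaj_def cgap_def)
qed

lemma gvar_union_far:
  assumes d: "16 \<le> d" and r: "2 \<le> r" and fin: "finite A" "finite B"
    and far: "\<And>x y. x \<in> A \<Longrightarrow> y \<in> B \<Longrightarrow> far d r x y"
  shows "gvar d (A \<union> B) \<le> gvar d A + gvar d B + 2 * real (card A) * real (card B) * (cgap / (real d)\<^sup>2 / (real r)\<^sup>2)"
    and "A \<inter> B = {}"
proof -
  show disj: "A \<inter> B = {}"
  proof -
    have "\<not> far d r x x" for x using r by (simp add: far_def)
    thus ?thesis using far by blast
  qed
  define g where "g = cgap / (real d)\<^sup>2 / (real r)\<^sup>2"
  have "(\<Sum>x\<in>A. \<Sum>y\<in>B. green d x y) \<le> (\<Sum>x\<in>A. \<Sum>y\<in>B. g)"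
    unfolding g_def by (intro sum_mono green_le_far[OF d r] far)
  moreover have "(\<Sum>x\<in>B. \<Sum>y\<in>A. green d x y) \<le> (\<Sum>x\<in>B. \<Sum>y\<in>A. g)"
    unfolding g_def using far far_sym by (intro sum_mono green_le_far[OF d r]) blast
  moreover have "gvar d (A \<union> B) = gvar d A + gvar d B + (\<Sum>x\<in>A. \<Sum>y\<in>B. green d x y) + (\<Sum>x\<in>B. \<Sum>y\<in>A. green d x y)"
    using fin disj by (simp add: gvar_def sum.union_disjoint sum.distrib)
  ultimately show "gvar d (A \<union> B) \<le> gvar d A + gvar d B + 2 * real (card A) * real (card B) * (cgap / (real d)\<^sup>2 / (real r)\<^sup>2)"
    unfolding g_def[symmetric] by (simp add: algebra_simps)
qed

text \<open>In each row of the covariance the diagonal gives \<open>green0 d\<close>, at most two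
  neighbours on the path give \<open>1 / d\<close> each, and the far field gives at most
  \<open>cgap / d\<^sup>2\<close> per vertex.\<close>

lemma gvar_induced_path:
  assumes d: "16 \<le> d" and p: "induced d p"
  shows "gvar d (set p) \<le> real (length p) * (green0 d + 2 / real d + real (length p) * (cgap / (real d)\<^sup>2))"
proof -
  have fin: "finite (set p)" and dist: "distinct p" and lat: "set p \<subseteq> lattice d" using p by (auto simp: induced_def)
  have "(\<Sum>y\<in>set p. green d x y) \<le> green0 d + 2 / real d + real (length p) * (cgap / (real d)\<^sup>2)" if x: "x \<in> set p" for x
  proof -
    obtain i where i: "i < length p" "x = p ! i" using x by (metis in_set_conv_nth)
    let ?N = "{y \<in> set p. nn d x y}"
    \<comment> \<open>At the ends of the path \<open>i - 1\<close> truncates to 0 or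
      \<open>p ! Suc i\<close> is out of range; this is harmless, since the set serves only to bound
      the number of neighbours by 2.\<close>
    have "?N \<subseteq> {p ! Suc i, p ! (i - 1)}"
    proof
      fix y assume y: "y \<in> ?N"
      then obtain j where j: "j < length p" "y = p ! j" by (auto simp: in_set_conv_nth)
      thus "y \<in> {p ! Suc i, p ! (i - 1)}"
        using induced_nn_nth[OF p i(1) j(1)] y i by auto
    qed
    hence "card ?N \<le> card {p ! Suc i, p ! (i - 1)}" by (intro card_mono) auto
    also have "\<dots> \<le> 2" by (simp add: card_insert_if)
    finally have N: "card ?N \<le> 2" .
    have "(\<Sum>y\<in>set p. green d x y) = green d x x + (\<Sum>y\<in>set p - {x}. green d x y)"
      using x fin by (simp add: sum.remove)
    also have "(\<Sum>y\<in>set p - {x}. green d x y)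
      \<le> (\<Sum>y\<in>set p - {x}. (if nn d x y then 1 / real d else 0) + cgap / (real d)\<^sup>2)"
      using x lat by (intro sum_mono green_le_gap[OF d]) auto
    also have "\<dots> \<le> (\<Sum>y\<in>set p. (if nn d x y then 1 / real d else 0) + cgap / (real d)\<^sup>2)"
      using fin by (intro sum_mono2) (auto simp: cgap_def)
    also have "\<dots> = real (card ?N) / real d + real (length p) * (cgap / (real d)\<^sup>2)"
      using fin distinct_card[OF dist] by (simp add: sum.distrib sum.If_cases Collect_conj_eq)
    also have "\<dots> \<le> 2 / real d + real (length p) * (cgap / (real d)\<^sup>2)"
      using N by (intro add_right_mono divide_right_mono) auto
    finally show ?thesis by (simp add: green_diag)
  qed
  hence "gvar d (set p) \<le> (\<Sum>x\<in>set p. green0 d + 2 / real d + real (length p) * (cgap / (real d)\<^sup>2))"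
    unfolding gvar_def by (intro sum_mono)
  thus ?thesis using distinct_card[OF dist] by simp
qed

text \<open>\<open>2 - 2 / 2 ^ k\<close> is the sum of \<open>1 / 2 ^ j\<close> over
  \<open>j < k\<close>: joining two halves of level \<open>j\<close> costs at most
  \<open>cgap / d\<^sup>2 / 2 ^ j\<close> per vertex. With \<open>r = radius n k\<close>, the halves
  lie within \<open>2 * r\<close> of centres at distance \<open>5 * r\<close>, hence are at least
  \<open>r\<close> apart.\<close>

lemma config_props:
  assumes d: "16 \<le> d" and n: "2 \<le> n" and "x \<in> lattice d" "A \<in> config d n k x"
  shows "A \<subseteq> cube d x (2 * radius n k) \<and> card A = n * 2 ^ k \<and>
    gvar d A \<le> real (card A) * (green0 d + 2 / real d + real n * (cgap / (real d)\<^sup>2) + cgap / (real d)\<^sup>2 * (2 - 2 / 2 ^ k))"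
  using assms(3,4)
proof (induction k arbitrary: x A)
  case 0
  then obtain p where p: "A = set p" "induced d p" "length p = n" "hd p = x" by auto
  have "y \<in> cube d x (2 * n)" if y: "y \<in> A" for y
  proof -
    obtain m where m: "m < length p" "y = p ! m" using y p by (metis in_set_conv_nth)
    have "\<bar>y i - x i\<bar> \<le> int (2 * n)" if "i < d" for i
      using walk_coord[of d p i m] that m p by (auto simp: induced_def)
    thus ?thesis using p y by (auto simp: cube_def induced_def)
  qed
  thus ?case using gvar_induced_path[OF d p(2)] p distinct_card[of p] by (auto simp: induced_def)
next
  case (Suc k)
  obtain A0 B0 z where C: "A = A0 \<union> B0" "A0 \<in> config d n k x" "z \<in> cube d x (radius n (Suc k))"
    "far d (radius n (Suc k)) x z" "B0 \<in> config d n k z" using Suc.prems(2) by auto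
  define v where "v = green0 d + 2 / real d + real n * (cgap / (real d)\<^sup>2) + cgap / (real d)\<^sup>2 * (2 - 2 / 2 ^ k)"
  have z: "z \<in> lattice d" using C(3) by (simp add: cube_def)
  have A0: "A0 \<subseteq> cube d x (2 * radius n k)" "card A0 = n * 2 ^ k" "gvar d A0 \<le> real (card A0) * v"
    and B0: "B0 \<subseteq> cube d z (2 * radius n k)" "card B0 = n * 2 ^ k" "gvar d B0 \<le> real (card B0) * v"
    using Suc.IH[OF Suc.prems(1) C(2)] Suc.IH[OF z C(5)] unfolding v_def by blast+
  have fin: "finite A0" "finite B0" using A0 B0 cube_card finite_subset by blast+
  have L: "2 \<le> radius n k"
    using mult_le_mono[OF n, of 1 "5 ^ k"] by simp
  have sep: "far d (radius n k) a b" if a: "a \<in> A0" and b: "b \<in> B0" for a b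
  proof -
    obtain i where i: "i < d" "int (radius n (Suc k)) \<le> \<bar>z i - x i\<bar>" using C(4) by (auto simp: far_def)
    have "\<bar>a i - x i\<bar> \<le> int (2 * radius n k)" "\<bar>b i - z i\<bar> \<le> int (2 * radius n k)"
      using a b A0 B0 i(1) by (auto simp: cube_def)
    moreover have "int (radius n (Suc k)) = 5 * int (radius n k)" "int (2 * radius n k) = 2 * int (radius n k)" by simp_all
    ultimately have "int (radius n k) \<le> \<bar>b i - a i\<bar>" using i(2) by linarith
    thus ?thesis using i(1) unfolding far_def by blast
  qed
  have un: "gvar d (A0 \<union> B0) \<le> gvar d A0 + gvar d B0 +
      2 * real (card A0) * real (card B0) * (cgap / (real d)\<^sup>2 / (real (radius n k))\<^sup>2)"
    "A0 \<inter> B0 = {}"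
    using gvar_union_far[OF d L fin] sep by blast+
  have cardA: "card A = 2 * (n * 2 ^ k)" using un(2) fin A0 B0 by (simp add: C card_Un_disjoint)
  have sub: "A \<subseteq> cube d x (2 * radius n (Suc k))"
  proof
    fix y assume y: "y \<in> A"
    have "\<bar>y i - x i\<bar> \<le> int (2 * radius n (Suc k))" if i: "i < d" for i
    proof -
      have "\<bar>y i - x i\<bar> \<le> int (2 * radius n k) \<or> \<bar>y i - z i\<bar> \<le> int (2 * radius n k)"
        using y A0 B0 i by (auto simp: cube_def C)
      moreover have "\<bar>z i - x i\<bar> \<le> int (radius n (Suc k))" using C(3) i by (auto simp: cube_def)
      moreover have "int (radius n (Suc k)) = 5 * int (radius n k)" "int (2 * radius n k) = 2 * int (radius n k)"
        "int (2 * radius n (Suc k)) = 10 * int (radius n k)" by simp_all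
      ultimately show ?thesis by linarith
    qed
    moreover have "y \<in> lattice d" using y A0 B0 by (auto simp: cube_def C)
    ultimately show "y \<in> cube d x (2 * radius n (Suc k))" by (simp add: cube_def)
  qed
  define c where "c = cgap / (real d)\<^sup>2"
  have c0: "0 \<le> c" by (simp add: c_def cgap_def)
  \<comment> \<open>Cross-covariance per vertex: \<open>n * 2 ^ k\<close> points against the squared
    separation \<open>n\<^sup>2 * 25 ^ k\<close>; \<open>4 ^ k \<le> 25 ^ k\<close> leaves the
    summable \<open>1 / 2 ^ k\<close>.\<close>
  have small: "real (n * 2 ^ k) * (c / (real (radius n k))\<^sup>2) \<le> c * (1 / 2 ^ k)"
  proof -
    have "(4::real) ^ k \<le> 25 ^ k" by (intro power_mono) auto
    also have "(25::real) ^ k = 1 * (5 ^ k * 5 ^ k)" by (simp flip: power_mult_distrib)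
    also have "\<dots> \<le> real n * (5 ^ k * 5 ^ k)" using n by (intro mult_right_mono) auto
    finally have "(2::real) ^ k * 2 ^ k \<le> real n * (5 ^ k * 5 ^ k)" by (simp flip: power_mult_distrib)
    hence "real n * (2 ^ k * 2 ^ k) \<le> real n * (real n * (5 ^ k * 5 ^ k))" by (intro mult_left_mono) auto
    hence "real (n * 2 ^ k) * (1 / (real (radius n k))\<^sup>2) \<le> 1 / 2 ^ k"
      using n by (simp add: divide_simps power2_eq_square mult_ac)
    from mult_left_mono[OF this c0] show ?thesis by (simp add: mult_ac)
  qed
  have "gvar d A \<le> real (n * 2 ^ k) * v + real (n * 2 ^ k) * v + 2 * real (n * 2 ^ k) * real (n * 2 ^ k) * (c / (real (radius n k))\<^sup>2)"
    using un(1) A0(3) B0(3) unfolding C(1) c_def A0(2) B0(2) by linarith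
  also have "\<dots> = 2 * real (n * 2 ^ k) * (v + real (n * 2 ^ k) * (c / (real (radius n k))\<^sup>2))"
    by (simp only: distrib_left)
  also have "\<dots> \<le> 2 * real (n * 2 ^ k) * (v + c * (1 / 2 ^ k))"
    by (intro mult_left_mono add_left_mono small) auto
  also have "v + c * (1 / 2 ^ k) = green0 d + 2 / real d + real n * c + c * (2 - 2 / 2 ^ Suc k)"
    by (simp add: v_def c_def algebra_simps)
  finally show ?case using cardA sub by (simp add: c_def)
qed

subsection \<open>Absence of crossings above the asymptotic level\<close>

lemma ex_radius_bracket:
  assumes "0 < n" "radius n j \<le> L"
  shows "\<exists>k\<ge>j. radius n k \<le> L \<and> L < radius n (Suc k)"
proof -
  define k where "k = (LEAST k. L < radius n (Suc k))"
  have "L < 5 ^ Suc L" by (induction L) auto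
  also have "\<dots> \<le> radius n (Suc L)" using assms by simp
  finally have ex: "L < radius n (Suc L)" .
  have up: "L < radius n (Suc k)"
    unfolding k_def by (rule LeastI[of "\<lambda>k. L < radius n (Suc k)", OF ex])
  have jk: "j \<le> k"
  proof (rule ccontr)
    assume "\<not> j \<le> k"
    hence "radius n (Suc k) \<le> radius n j" by (intro mult_le_mono2 power_increasing) auto
    thus False using up assms by linarith
  qed
  have "radius n k \<le> L"
  proof (cases "k = j")
    case True thus ?thesis using assms by simp
  next
    case False
    then obtain k' where k': "k = Suc k'" using jk by (cases k) auto
    have "\<not> L < radius n (Suc k')"
      by (rule not_less_Least[of k' "\<lambda>k. L < radius n (Suc k)"]) (use k' k_def in simp)
    thus ?thesis using k' by simp
  qed
  thus ?thesis using up jk by blast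
qed

text \<open>A coordinate with absolute value \<open>2 * L\<close> at the end of the path is at most
  \<open>L\<close> in absolute value at its start, so the chordless subpath travels sup-distance at
  least \<open>L\<close>. The factor \<open>1 *\<close> matches the sign parameter of the Gaussian
  bound.\<close>

lemma crossing_subset_config:
  assumes n: "0 < n" and L: "radius n k \<le> L"
  shows "crossing d M phi h L \<subseteq> (\<Union>x\<in>cube d (\<lambda>_. 0) L. \<Union>A\<in>config d n k x. {\<omega> \<in> space M. \<forall>y\<in>A. h \<le> 1 * phi y \<omega>})"
proof
  fix \<omega> assume "\<omega> \<in> crossing d M phi h L"
  then obtain p where w: "\<omega> \<in> space M" and p: "p \<noteq> []" "hd p \<in> ball_inf d L" "last p \<in> sphere_inf d (2 * L)"
    "set p \<subseteq> lattice d" "\<forall>x\<in>set p. h \<le> phi x \<omega>" "\<forall>k. Suc k < length p \<longrightarrow> nn d (p ! k) (p ! Suc k)"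
    by (auto simp: crossing_def)
  obtain q where q: "induced d q" "hd q = hd p" "last q = last p" "set q \<subseteq> set p"
    using ex_induced_subpath[OF p(1,4) successively_nthI] p(6) by blast
  obtain i where i: "i < d" "\<bar>last p i\<bar> = int (2 * L)" using p(3) by (auto simp: sphere_inf_def)
  have "\<bar>hd p i\<bar> \<le> int L" using p(2) i by (auto simp: ball_inf_def)
  hence "int L \<le> \<bar>last p i - hd p i\<bar>" using i by simp
  hence "far d (radius n k) (hd q) (last q)"
    using i(1) L far_mono[of d L "hd q" "last q" "radius n k"] unfolding q far_def by blast
  then obtain A where A: "A \<in> config d n k (hd q)" "A \<subseteq> set q"
    using path_contains_config[OF q(1) n] by blast
  have "hd q \<in> cube d (\<lambda>_. 0) L" using p(2) q by (auto simp: cube_def ball_inf_def)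
  moreover have "\<forall>y\<in>A. h \<le> 1 * phi y \<omega>" using A(2) q(4) p(5) by auto
  ultimately show "\<omega> \<in> (\<Union>x\<in>cube d (\<lambda>_. 0) L. \<Union>A\<in>config d n k x. {\<omega> \<in> space M. \<forall>y\<in>A. h \<le> 1 * phi y \<omega>})"
    using A(1) w by blast
qed

lemma GFF_event_sets:
  assumes "is_GFF d M phi" "finite A" "A \<subseteq> lattice d"
  shows "{\<omega> \<in> space M. \<forall>x\<in>A. h \<le> s * phi x \<omega>} \<in> sets M"
proof -
  have "phi x \<in> borel_measurable M" if "x \<in> A" for x using assms that by (auto simp: is_GFF_def)
  thus ?thesis using assms(2) by (intro sets.sets_Collect_finite_All) measurable
qed

text \<open>Union bound over starting points and configurations. All configurations have
  \<open>n * 2 ^ k\<close> vertices and share one Gaussian bound, so the result is a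
  \<open>2 ^ k\<close>-th power whose base does not depend on the scale.\<close>

lemma crossing_le:
  assumes G: "is_GFF d M phi" and d: "16 \<le> d" and n: "2 \<le> n" and h: "0 \<le> h"
    and k: "radius n k \<le> L" "L < radius n (Suc k)"
    and v: "v = green0 d + 2 / real d + (real n + 2) * (cgap / (real d)\<^sup>2)"
  shows "measure M (crossing d M phi h L) \<le> ((125 * real n) ^ d * (2 * real d) ^ n * exp (- h\<^sup>2 * real n / (2 * v))) ^ 2 ^ k"
proof -
  interpret prob_space M using G by (simp add: is_GFF_def)
  let ?E = "\<lambda>A. {\<omega> \<in> space M. \<forall>y\<in>A. h \<le> 1 * phi y \<omega>}"
  let ?X = "cube d (\<lambda>_. 0) L"
  let ?C = "config d n k"
  define e where "e = exp (- h\<^sup>2 * real n / (2 * v)) ^ 2 ^ k"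
  define U :: nat where "U = (125 * n) ^ d * (2 * d) ^ n"
  have v1: "1 \<le> v" unfolding v add.assoc using green0_ge_1[OF d]
    by (intro add_increasing2) (auto simp: cgap_def)
  have fin: "finite (?C x)" and card: "card (?C x) * (125 * radius n k) ^ d \<le> U ^ 2 ^ k" for x
    using config_finite_card[of d n k x] d n by (auto simp: U_def)
  have CA: "finite A" "A \<noteq> {}" "A \<subseteq> lattice d" "card A = n * 2 ^ k" "gvar d A \<le> real (card A) * v"
    if x: "x \<in> ?X" and A: "A \<in> ?C x" for x A
  proof -
    have xl: "x \<in> lattice d" using x by (simp add: cube_def)
    note P = config_props[OF d n xl A]
    show "finite A" using P cube_card(1) finite_subset by blast
    show "A \<subseteq> lattice d" using P by (auto simp: cube_def)
    show c: "card A = n * 2 ^ k" using P by simp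
    show "A \<noteq> {}" using c n by auto
    \<comment> \<open>The geometric sum is replaced by its limit 2, the source of
      \<open>real n + 2\<close> in \<open>v\<close>.\<close>
    have "cgap / (real d)\<^sup>2 * (2 - 2 / 2 ^ k) \<le> cgap / (real d)\<^sup>2 * 2"
      by (intro mult_left_mono) (auto simp: cgap_def)
    hence "green0 d + 2 / real d + real n * (cgap / (real d)\<^sup>2) + cgap / (real d)\<^sup>2 * (2 - 2 / 2 ^ k) \<le> v"
      unfolding v distrib_right by linarith
    thus "gvar d A \<le> real (card A) * v"
      using P mult_left_mono[of _ v "real (card A)"] order_trans by (metis of_nat_0_le_iff)
  qed
  have E: "measure M (?E A) \<le> e" "?E A \<in> sets M" if x: "x \<in> ?X" and A: "A \<in> ?C x" for x A
  proof -
    have "measure M (?E A) \<le> exp (- (h * real (card A))\<^sup>2 / (2 * (real (card A) * v)))"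
      by (rule GFF_all_ge_le[OF G d]) (use CA[OF x A] h in auto)
    also have "- (h * real (card A))\<^sup>2 / (2 * (real (card A) * v)) = 2 ^ k * (- h\<^sup>2 * real n / (2 * v))"
      unfolding CA(4)[OF x A] using n v1 by (simp add: power2_eq_square field_simps)
    also have "exp \<dots> = e" unfolding e_def by (simp only: exp_of_nat_mult[symmetric] of_nat_power of_nat_numeral)
    finally show "measure M (?E A) \<le> e" .
    show "?E A \<in> sets M" using GFF_event_sets[OF G] CA[OF x A] by blast
  qed
  have "measure M (crossing d M phi h L) \<le> measure M (\<Union>x\<in>?X. \<Union>A\<in>?C x. ?E A)"
    using E(2) fin cube_card(1) n k by (intro finite_measure_mono crossing_subset_config sets.finite_UN) auto
  also have "\<dots> \<le> (\<Sum>x\<in>?X. measure M (\<Union>A\<in>?C x. ?E A))"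
    using E(2) fin cube_card(1) by (intro finite_measure_subadditive_finite) (auto intro!: sets.finite_UN)
  also have "\<dots> \<le> (\<Sum>x\<in>?X. \<Sum>A\<in>?C x. measure M (?E A))"
    using E(2) fin by (intro sum_mono finite_measure_subadditive_finite) auto
  also have "\<dots> \<le> (\<Sum>x\<in>?X. \<Sum>A\<in>?C x. e)"
    using E(1) by (intro sum_mono) auto
  also have "\<dots> = (\<Sum>x\<in>?X. real (card (?C x))) * e"
    by (simp add: sum_distrib_right)
  also have "\<dots> \<le> real (U ^ 2 ^ k) * e"
  proof (rule mult_right_mono)
    let ?Q = "(125 * radius n k) ^ d"
    \<comment> \<open>As \<open>L < 5 * radius n k\<close>, the number of starting points is
      absorbed by the spare factor in the count of configurations.\<close>
    have "2 * L + 1 \<le> 125 * radius n k" using k n by simp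
    hence "(2 * L + 1) ^ d \<le> ?Q" by (rule power_mono) simp
    hence X: "card ?X \<le> ?Q" using cube_card(2)[of d "\<lambda>_. 0" L] by linarith
    have "(\<Sum>x\<in>?X. card (?C x)) * ?Q = (\<Sum>x\<in>?X. card (?C x) * ?Q)" by (rule sum_distrib_right)
    also have "\<dots> \<le> (\<Sum>x\<in>?X. U ^ 2 ^ k)" by (intro sum_mono card)
    also have "\<dots> = card ?X * U ^ 2 ^ k" by simp
    also have "\<dots> \<le> ?Q * U ^ 2 ^ k" using X by (rule mult_le_mono1)
    finally have "?Q * (\<Sum>x\<in>?X. card (?C x)) \<le> ?Q * U ^ 2 ^ k" by (simp only: mult.commute)
    moreover have "0 < ?Q" using n by simp
    ultimately have "(\<Sum>x\<in>?X. card (?C x)) \<le> U ^ 2 ^ k" by (simp only: mult_le_cancel1) 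
    thus "(\<Sum>x\<in>?X. real (card (?C x))) \<le> real (U ^ 2 ^ k)" by (simp only: of_nat_sum[symmetric] of_nat_le_iff)
  qed (simp add: e_def)
  also have "\<dots> = ((125 * real n) ^ d * (2 * real d) ^ n * exp (- h\<^sup>2 * real n / (2 * v))) ^ 2 ^ k"
    unfolding e_def U_def by (simp only: power_mult_distrib of_nat_mult of_nat_power of_nat_numeral)
  finally show ?thesis .
qed

text \<open>The base is the same at every scale, so once \<open>L\<close> is at least
  \<open>radius n j\<close> the bound is at most its \<open>j\<close>-th power.\<close>

lemma crossing_tendsto_0:
  assumes G: "is_GFF d M phi" and d: "16 \<le> d" and n: "2 \<le> n" and h: "0 \<le> h"
    and th: "(125 * real n) ^ d * (2 * real d) ^ n * exp (- h\<^sup>2 * real n / (2 * v)) < 1" (is "?\<theta> < 1")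
    and v: "v = green0 d + 2 / real d + (real n + 2) * (cgap / (real d)\<^sup>2)"
  shows "(\<lambda>L. measure M (crossing d M phi h L)) \<longlonglongrightarrow> 0"
proof (rule LIMSEQ_I)
  fix r :: real assume r: "0 < r"
  have th0: "0 \<le> ?\<theta>" by simp
  obtain j where j: "?\<theta> ^ j < r" using real_arch_pow_inv[OF r th] by blast
  have "norm (measure M (crossing d M phi h L) - 0) < r" if L: "radius n j \<le> L" for L
  proof -
    obtain k where k: "j \<le> k" "radius n k \<le> L" "L < radius n (Suc k)"
      using ex_radius_bracket[OF _ L] n by auto
    have "measure M (crossing d M phi h L) \<le> ?\<theta> ^ 2 ^ k"
      by (rule crossing_le[OF G d n h k(2,3) v])
    also have "\<dots> \<le> ?\<theta> ^ j"
      using th th0 k(1) less_exp[of k] by (intro power_decreasing) linarith+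
    finally show ?thesis using j by simp
  qed
  thus "\<exists>no. \<forall>L\<ge>no. norm (measure M (crossing d M phi h L) - 0) < r" by blast
qed

text \<open>For \<open>n = K * d\<close> the logarithm, divided by \<open>d\<close>, is at most
  \<open>ln (125 * K) + K * ln 2 + (1 - e * K) * ln d\<close>: placing a piece costs one
  \<open>ln d\<close>, while each of its vertices gains \<open>e * ln d\<close>.\<close>

lemma subcritical_level:
  fixes e :: real
  assumes e: "0 < e"
  shows "\<forall>\<^sub>F d in sequentially. \<exists>n. 2 \<le> n \<and> (125 * real n) ^ d * (2 * real d) ^ n *
     exp (- ((1 + e) * h_as d)\<^sup>2 * real n / (2 * (green0 d + 2 / real d + (real n + 2) * (cgap / (real d)\<^sup>2)))) < 1"
proof -
  \<comment> \<open>Chosen so that \<open>e * K \<ge> 2\<close>, which makes the coefficient of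
    \<open>ln d\<close> at most -1.\<close>
  define K where "K = nat \<lceil>2 / e\<rceil>"
  have eK: "2 \<le> e * real K"
  proof -
    have "2 / e \<le> real K" unfolding K_def by (simp add: real_nat_ceiling_ge)
    thus ?thesis using e by (simp add: field_simps)
  qed
  hence K: "1 \<le> K" by (cases K) auto
  \<comment> \<open>Beyond \<open>D1\<close> the corrections to \<open>green0 d\<close> in the
    variance are at most \<open>e\<close>; beyond \<open>D2\<close> the term \<open>ln d\<close>
    beats the constants.\<close>
  define D1 where "D1 = (2 + (real K + 2) * cgap) / e"
  define D2 where "D2 = exp (ln (125 * real K) + real K * ln 2)"
  have "(125 * real n) ^ d * (2 * real d) ^ n *
     exp (- ((1 + e) * h_as d)\<^sup>2 * real n / (2 * (green0 d + 2 / real d + (real n + 2) * (cgap / (real d)\<^sup>2)))) < 1"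
    if d: "16 \<le> d" and d1: "D1 \<le> real d" and d2: "D2 < real d" and n: "n = K * d" for d n
  proof -
    define v where "v = green0 d + 2 / real d + (real n + 2) * (cgap / (real d)\<^sup>2)"
    have g: "1 \<le> green0 d" by (rule green0_ge_1[OF d])
    have ld: "0 < ln (real d)" using d by simp
    have dd: "real d \<le> (real d)\<^sup>2" using d by (simp add: power2_eq_square)
    have "(real n + 2) * (cgap / (real d)\<^sup>2) = real K * cgap / real d + 2 * cgap / (real d)\<^sup>2"
      using d by (simp add: n power2_eq_square field_simps)
    also have "\<dots> \<le> real K * cgap / real d + 2 * cgap / real d"
      using d dd by (intro add_left_mono divide_left_mono) (auto simp: cgap_def)
    finally have "2 / real d + (real n + 2) * (cgap / (real d)\<^sup>2) \<le> (2 + (real K + 2) * cgap) / real d"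
      by (simp add: add_divide_distrib distrib_right)
    also have "\<dots> \<le> e" using d1 e d by (simp add: D1_def field_simps)
    finally have "v \<le> green0 d + e" by (simp add: v_def)
    \<comment> \<open>\<open>green0 d \<ge> 1\<close> turns the additive error into a factor
      \<open>1 + e\<close>, which cancels one of the two such factors in the squared level.\<close>
    also have "\<dots> \<le> green0 d * (1 + e)" using g e by (simp add: algebra_simps)
    finally have v: "v \<le> green0 d * (1 + e)" .
    have v0: "0 < v" using g by (simp add: v_def cgap_def add_pos_nonneg)
    have hsq: "((1 + e) * h_as d)\<^sup>2 = (1 + e)\<^sup>2 * (2 * green0 d * ln (real d))"
      using g ld by (simp add: h_as_def power_mult_distrib)
    have "(1 + e) * ln (real d) * v \<le> (1 + e) * ln (real d) * (green0 d * (1 + e))"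
      using v e ld by (intro mult_left_mono) auto
    hence "(1 + e) * ln (real d) \<le> ((1 + e) * h_as d)\<^sup>2 / (2 * v)"
      unfolding hsq using v0 by (simp add: field_simps power2_eq_square)
    hence "((1 + e) * ln (real d)) * real n \<le> ((1 + e) * h_as d)\<^sup>2 / (2 * v) * real n"
      by (rule mult_right_mono) simp
    hence E: "exp (- ((1 + e) * h_as d)\<^sup>2 * real n / (2 * v)) \<le> exp (- ((1 + e) * ln (real d) * real n))"
      by simp
    have p1: "(125 * real n) ^ d = exp (real d * (ln (125 * real K) + ln (real d)))"
    proof -
      have "125 * real n = exp (ln (125 * real K) + ln (real d))"
        using K d by (simp add: exp_add n)
      thus ?thesis by (simp only: exp_of_nat_mult)
    qed
    have p2: "(2 * real d) ^ n = exp (real n * (ln 2 + ln (real d)))"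
    proof -
      have "2 * real d = exp (ln 2 + ln (real d))" using d by (simp add: exp_add)
      thus ?thesis by (simp only: exp_of_nat_mult)
    qed
    have "(125 * real n) ^ d * (2 * real d) ^ n * exp (- ((1 + e) * h_as d)\<^sup>2 * real n / (2 * v))
      \<le> (125 * real n) ^ d * (2 * real d) ^ n * exp (- ((1 + e) * ln (real d) * real n))"
      by (rule mult_left_mono[OF E]) simp
    also have "\<dots> = exp (real d * (ln (125 * real K) + ln (real d)) + real n * (ln 2 + ln (real d)) - (1 + e) * ln (real d) * real n)"
      unfolding p1 p2 by (simp add: exp_add exp_diff exp_minus divide_inverse)
    also have "real d * (ln (125 * real K) + ln (real d)) + real n * (ln 2 + ln (real d)) - (1 + e) * ln (real d) * real n
       = real d * (ln (125 * real K) + real K * ln 2 + (1 - e * real K) * ln (real d))"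
      by (simp add: n algebra_simps)
    also have "exp \<dots> < 1"
    proof -
      have "(1 - e * real K) * ln (real d) \<le> (-1) * ln (real d)"
        using eK ld by (intro mult_right_mono) auto
      moreover have "ln (125 * real K) + real K * ln 2 < ln (real d)"
      proof -
        have "ln D2 < ln (real d)" using d2 d by (subst ln_less_cancel_iff) (auto simp: D2_def)
        thus ?thesis unfolding D2_def ln_exp .
      qed
      ultimately have "ln (125 * real K) + real K * ln 2 + (1 - e * real K) * ln (real d) < 0" by linarith
      thus ?thesis using d by (simp add: mult_pos_neg)
    qed
    finally show ?thesis by (simp add: v_def)
  qed
  note small = this
  have two: "2 \<le> K * d" if "16 \<le> d" for d
    using mult_le_mono[OF K that] by simp
  have "\<forall>\<^sub>F d in sequentially. D1 \<le> real d" "\<forall>\<^sub>F d in sequentially. D2 + 1 \<le> real d"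
    using filterlim_real_sequentially unfolding filterlim_at_top by blast+
  thus ?thesis using eventually_ge_at_top[of 16]
  proof eventually_elim
    case (elim d)
    show ?case
    proof (intro exI[of _ "K * d"] conjI two)
      show "16 \<le> d" by (rule elim)
    qed (rule small; use elim in simp)
  qed
qed

subsection \<open>Planar duality and Peierls bounds\<close>

text \<open>When a vertex recurs, the path is cut at its earlier visit. The last conjunct keeps that
  every later vertex is the target of a step, which is where the step relations below put their
  conditions.\<close>

lemma rtranclp_distinct_path:
  assumes "R\<^sup>*\<^sup>* x y"
  shows "\<exists>p. p \<noteq> [] \<and> hd p = x \<and> last p = y \<and> successively R p \<and> distinct p \<and> (\<forall>z\<in>set (tl p). \<exists>u. R u z)"
  using assms
proof induction
  case base
  show ?case by (rule exI[of _ "[x]"]) simp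
next
  case (step y z)
  then obtain p where p: "p \<noteq> []" "hd p = x" "last p = y" "successively R p" "distinct p" "\<forall>z\<in>set (tl p). \<exists>u. R u z"
    by blast
  show ?case
  proof (cases "z \<in> set p")
    case True
    then obtain u v where uv: "p = (u @ [z]) @ v" by (metis append.assoc append_Cons append_Nil split_list)
    hence "hd (u @ [z]) = x" using p by (cases u) auto
    moreover have "successively R (u @ [z])" using p(4) uv successively_append_iff by blast
    moreover have "set (tl (u @ [z])) \<subseteq> set (tl p)" using uv by (cases u) auto
    ultimately show ?thesis using p uv by (intro exI[of _ "u @ [z]"]) auto
  next
    case False
    thus ?thesis using p step(2)
      by (intro exI[of _ "p @ [z]"]) (auto simp: successively_append_iff)
  qed
qed

definition adj4 :: "nat \<times> nat \<Rightarrow> nat \<times> nat \<Rightarrow> bool" where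
  "adj4 u v \<longleftrightarrow> fst u = fst v \<and> (snd v = Suc (snd u) \<or> snd u = Suc (snd v)) \<or>
     snd u = snd v \<and> (fst v = Suc (fst u) \<or> fst u = Suc (fst v))"

text \<open>King moves together with equality, so that any corner of a unit square reaches all its
  corners, itself included, in one step.\<close>

definition adj8 :: "nat \<times> nat \<Rightarrow> nat \<times> nat \<Rightarrow> bool" where
  "adj8 u v \<longleftrightarrow> fst v \<le> Suc (fst u) \<and> fst u \<le> Suc (fst v) \<and> snd v \<le> Suc (snd u) \<and> snd u \<le> Suc (snd v)"

text \<open>Only the target must be open and lie in columns 1 to \<open>m\<close>; a path may thus
  start in the auxiliary column 0.\<close>

definition open_step :: "(nat \<times> nat \<Rightarrow> bool) \<Rightarrow> nat \<Rightarrow> nat \<Rightarrow> nat \<times> nat \<Rightarrow> nat \<times> nat \<Rightarrow> bool" where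
  "open_step Op m n u v \<longleftrightarrow> adj4 u v \<and> v \<in> {1..m} \<times> {0..n} \<and> Op v"

definition closed_step :: "(nat \<times> nat \<Rightarrow> bool) \<Rightarrow> nat \<Rightarrow> nat \<Rightarrow> nat \<times> nat \<Rightarrow> nat \<times> nat \<Rightarrow> bool" where
  "closed_step Op m n u v \<longleftrightarrow> adj8 u v \<and> v \<in> {1..m} \<times> {0..n} \<and> \<not> Op v"

text \<open>Column 0 is an auxiliary open column. Orient every edge from the open cluster \<open>C\<close> of that
  column to the closed cluster \<open>D\<close> of the bottom row. If neither cluster crosses, the resulting
  flow \<open>w\<close> is curl-free on each unit square, so its sum along a row does not depend on the row;
  but it is 1 on the bottom row and 0 on the top row.\<close>

lemma rectangle_duality:
  assumes m: "0 < m"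
  shows "(\<exists>b\<le>n. \<exists>b'\<le>n. (open_step Op m n)\<^sup>*\<^sup>* (0, b) (m, b')) \<or>
    (\<exists>a\<in>{1..m}. \<exists>a'\<in>{1..m}. \<not> Op (a, 0) \<and> (closed_step Op m n)\<^sup>*\<^sup>* (a, 0) (a', n))"
proof (rule ccontr)
  assume neg: "\<not> ?thesis"
  define C where "C = (\<lambda>u. \<exists>b\<le>n. (open_step Op m n)\<^sup>*\<^sup>* (0, b) u)"
  define D where "D = (\<lambda>u. \<exists>a\<in>{1..m}. \<not> Op (a, 0) \<and> (closed_step Op m n)\<^sup>*\<^sup>* (a, 0) u)"
  have C0: "C (0, b)" if "b \<le> n" for b using that by (auto simp: C_def)
  have Cstep: "C v" if "C u" "open_step Op m n u v" for u v
    using that by (auto simp: C_def intro: rtranclp.rtrancl_into_rtrancl)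
  have Dstep: "D v" if "D u" "closed_step Op m n u v" for u v
    using that by (auto simp: D_def intro: rtranclp.rtrancl_into_rtrancl)
  have D0: "D (a, 0)" if "1 \<le> a" "a \<le> m" "\<not> Op (a, 0)" for a using that by (auto simp: D_def)
  have Cm: "\<not> C (m, b)" if "b \<le> n" for b using neg that by (auto simp: C_def)
  have Copen: "fst u = 0 \<or> Op u" if "C u" for u
  proof -
    obtain b where "(open_step Op m n)\<^sup>*\<^sup>* (0, b) u" using \<open>C u\<close> by (auto simp: C_def)
    thus ?thesis by (cases rule: rtranclp.cases) (auto simp: open_step_def)
  qed
  have Dclosed: "1 \<le> fst u \<and> fst u \<le> m \<and> \<not> Op u" if "D u" for u
  proof -
    obtain a where "a \<in> {1..m}" "\<not> Op (a, 0)" "(closed_step Op m n)\<^sup>*\<^sup>* (a, 0) u" using \<open>D u\<close> by (auto simp: D_def)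
    from this(3,1,2) show ?thesis by (cases rule: rtranclp.cases) (auto simp: closed_step_def)
  qed
  have Dn: "\<not> D (a, n)" for a
  proof
    assume D: "D (a, n)"
    hence "a \<in> {1..m}" using Dclosed[of "(a, n)"] by auto
    thus False using neg D by (auto simp: D_def)
  qed
  have CD: "\<not> (C u \<and> D u)" for u using Copen[of u] Dclosed[of u] by auto
  define \<iota> where "\<iota> = (\<lambda>u. if C u then 1 else 0 :: int)"
  define w where "w = (\<lambda>u v. (if C u \<and> D v then 1 else 0) - (if C v \<and> D u then 1 else 0 :: int))"
  \<comment> \<open>If closed endpoints belong to \<open>D\<close>, an edge leaving \<open>C\<close>
    must end in \<open>D\<close>; hence \<open>w\<close> is the gradient of the indicator of
    \<open>C\<close> there.\<close>
  have w_pot: "w u v = \<iota> u - \<iota> v"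
    if "adj4 u v" "u \<in> {0..m} \<times> {0..n}" "v \<in> {0..m} \<times> {0..n}"
      and cl: "\<And>x. x \<in> {u, v} \<Longrightarrow> 1 \<le> fst x \<Longrightarrow> \<not> Op x \<Longrightarrow> D x" for u v
  proof -
    have *: "D y" if "C x" "\<not> C y" "adj4 x y" "y \<in> {0..m} \<times> {0..n}" "y \<in> {u, v}" for x y
    proof -
      have "fst y \<noteq> 0" using that C0[of "snd y"] by (metis atLeastAtMost_iff mem_Times_iff prod.collapse)
      moreover have "\<not> Op y" using that Cstep[of x y] \<open>fst y \<noteq> 0\<close> by (cases y) (auto simp: open_step_def)
      ultimately show ?thesis using cl that(5) by auto
    qed
    have "adj4 v u" using that(1) by (auto simp: adj4_def)
    thus ?thesis using *[of u v] *[of v u] that CD[of u] CD[of v] by (auto simp: w_def \<iota>_def)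
  qed
  have square: "w (a, b) (Suc a, b) + w (Suc a, b) (Suc a, Suc b) = w (a, b) (a, Suc b) + w (a, Suc b) (Suc a, Suc b)"
    if ab: "a < m" "b < n" for a b
  proof -
    let ?S = "{(a, b), (Suc a, b), (a, Suc b), (Suc a, Suc b)}"
    show ?thesis
    proof (cases "\<exists>y\<in>?S. D y")
      case False
      thus ?thesis by (simp add: w_def)
    next
      case True
      then obtain y where y: "y \<in> ?S" "D y" by blast
      \<comment> \<open>A corner in \<open>D\<close> is 8-adjacent to every corner, so all closed
        corners join \<open>D\<close> and \<open>w\<close> is a gradient around the square.\<close>
      have cl: "D x" if "x \<in> ?S" "1 \<le> fst x" "\<not> Op x" for x
      proof -
        have "adj8 y x" using y(1) that(1) by (auto simp: adj8_def)
        hence "closed_step Op m n y x" using that ab by (auto simp: closed_step_def)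
        thus ?thesis using Dstep y(2) by blast
      qed
      have "w (a, b) (Suc a, b) = \<iota> (a, b) - \<iota> (Suc a, b)"
        "w (Suc a, b) (Suc a, Suc b) = \<iota> (Suc a, b) - \<iota> (Suc a, Suc b)"
        "w (a, b) (a, Suc b) = \<iota> (a, b) - \<iota> (a, Suc b)"
        "w (a, Suc b) (Suc a, Suc b) = \<iota> (a, Suc b) - \<iota> (Suc a, Suc b)"
        by (rule w_pot; use ab cl in \<open>auto simp: adj4_def\<close>)+
      thus ?thesis by simp
    qed
  qed
  define H where "H = (\<lambda>b. \<Sum>a<m. w (a, b) (Suc a, b))"
  have "H (Suc b) = H b" if b: "b < n" for b
  proof -
    have "H (Suc b) - H b = (\<Sum>a<m. w (a, Suc b) (Suc a, Suc b) - w (a, b) (Suc a, b))"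
      by (simp add: H_def sum_subtractf)
    also have "\<dots> = (\<Sum>a<m. w (Suc a, b) (Suc a, Suc b) - w (a, b) (a, Suc b))"
      using square[OF _ b] by (intro sum.cong refl) (simp add: algebra_simps)
    also have "\<dots> = w (m, b) (m, Suc b) - w (0, b) (0, Suc b)"
      by (rule sum_lessThan_telescope)
    also have "w (m, b) (m, Suc b) = 0" using Cm b by (simp add: w_def)
    also have "w (0, b) (0, Suc b) = 0" using Dclosed[of "(0, _)"] by (auto simp: w_def)
    finally show ?thesis by simp
  qed
  hence "b \<le> n \<Longrightarrow> H b = H 0" for b by (induction b) auto
  from this[of n] have "H n = H 0" by blast
  moreover have "H n = 0" using Dn by (simp add: H_def w_def)
  \<comment> \<open>Closed vertices of the bottom row are in \<open>D\<close> by definition, so the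
    gradient telescopes from column 0, inside \<open>C\<close>, to column \<open>m\<close>, outside
    it.\<close>
  moreover have "H 0 = 1"
  proof -
    have "H 0 = (\<Sum>a<m. \<iota> (a, 0) - \<iota> (Suc a, 0))"
      unfolding H_def using D0
      by (intro sum.cong refl w_pot) (auto simp: adj4_def)
    also have "\<dots> = \<iota> (0, 0) - \<iota> (m, 0)" by (rule sum_lessThan_telescope')
    finally show ?thesis using C0[of 0] Cm[of 0] by (simp add: \<iota>_def)
  qed
  ultimately show False by simp
qed

section \<open>Summability of the Green function on a coordinate plane\<close>

lemma sum_inverse_square_le:
  fixes a :: int
  shows "(\<Sum>j\<le>n. 1 / (1 + (real_of_int (int j - a))\<^sup>2)) \<le> 8"
proof -
  \<comment> \<open>Telescoping comparison: \<open>f\<close> takes values in [-1, 1], and its unit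
    increments are at least a quarter of the summand, whence 8 = 4 * 2. The excluded range between
    -1 and 0 contains no integer.\<close>
  define f where "f = (\<lambda>t::real. t / (1 + \<bar>t\<bar>))"
  have aux: "1 / y \<le> 4 * (1 / x)" if "0 < x" "0 < y" "x \<le> 4 * y" for x y :: real
    using that by (simp add: field_simps)
  have step: "1 / (1 + t\<^sup>2) \<le> 4 * (f (t + 1) - f t)" if t: "0 \<le> t \<or> t \<le> -1" for t :: real
  proof (cases "0 \<le> t")
    case True
    have "f (t + 1) - f t = 1 / ((1 + t) * (2 + t))"
      using True by (simp add: f_def field_simps)
    moreover have "(1 + t) * (2 + t) \<le> 4 * (1 + t\<^sup>2)"
    proof -
      have "0 \<le> 3 * (t - 1/2)\<^sup>2 + 5/4" by simp
      thus ?thesis by (simp add: power2_eq_square algebra_simps)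
    qed
    moreover have "0 < (1 + t) * (2 + t)" using True by (intro mult_pos_pos) auto
    moreover have "0 < 1 + t\<^sup>2" by (simp add: add_pos_nonneg)
    ultimately show ?thesis using aux by (simp only:)
  next
    case False
    hence t': "t \<le> -1" using t by auto
    have "f (t + 1) - f t = 1 / ((- t) * (1 - t))"
      using t' by (simp add: f_def field_simps)
    moreover have "(- t) * (1 - t) \<le> 4 * (1 + t\<^sup>2)"
    proof -
      have "0 \<le> 3 * (t + 1/6)\<^sup>2 + 47/12" by simp
      thus ?thesis by (simp add: power2_eq_square algebra_simps)
    qed
    moreover have "0 < (- t) * (1 - t)" using t' by (intro mult_pos_pos) auto
    moreover have "0 < 1 + t\<^sup>2" by (simp add: add_pos_nonneg)
    ultimately show ?thesis using aux by (simp only:)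
  qed
  have "\<bar>f t\<bar> \<le> 1" for t by (simp add: f_def abs_divide divide_le_eq)
  hence bd: "4 * (f s - f t) \<le> 8" for s t using abs_le_D1[of "f s"] abs_le_D2[of "f t"] by smt
  have "(\<Sum>j\<le>n. 1 / (1 + (real_of_int (int j - a))\<^sup>2))
     \<le> (\<Sum>j\<le>n. 4 * (f (real_of_int (int j - a) + 1) - f (real_of_int (int j - a))))"
  proof (intro sum_mono step)
    show "0 \<le> real_of_int k \<or> real_of_int k \<le> -1" for k by (cases "0 \<le> k") (simp, linarith)
  qed
  also have "\<dots> = 4 * (\<Sum>j<Suc n. f (real_of_int (int (Suc j) - a)) - f (real_of_int (int j - a)))"
    unfolding sum_distrib_left lessThan_Suc_atMost by (intro sum.cong refl) (simp add: algebra_simps)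
  also have "\<dots> = 4 * (f (real_of_int (int (Suc n) - a)) - f (real_of_int (int 0 - a)))"
    by (subst sum_lessThan_telescope) simp
  also have "\<dots> \<le> 8" by (rule bd)
  finally show ?thesis .
qed

text \<open>Columns 1 and \<open>L + 1\<close> get first coordinates \<open>L\<close> and
  \<open>2 * L\<close>, so crossing them leads from the ball to the sphere; column 0 is the
  auxiliary column of the duality.\<close>

definition plane :: "nat \<Rightarrow> nat \<times> nat \<Rightarrow> nat \<Rightarrow> int" where
  "plane L u = (\<lambda>i. if i = 0 then int L + int (fst u) - 1 else if i = 1 then int (snd u) else 0)"

lemma plane_lattice: "2 \<le> d \<Longrightarrow> plane L u \<in> lattice d"
  by (auto simp: plane_def lattice_def)

lemma inj_plane: "inj (plane L)"
proof (rule injI)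
  fix u v assume "plane L u = plane L v"
  from fun_cong[OF this, of 0] fun_cong[OF this, of 1] show "u = v"
    by (auto simp: plane_def prod_eq_iff)
qed

lemma sum_two_coords:
  fixes f :: "nat \<Rightarrow> 'b::comm_monoid_add"
  assumes "2 \<le> d" "\<And>i. 2 \<le> i \<Longrightarrow> f i = 0"
  shows "(\<Sum>i<d. f i) = f 0 + f 1"
proof -
  have "(\<Sum>i<d. f i) = (\<Sum>i\<in>{0,1}. f i)"
  proof (rule sum.mono_neutral_right)
    show "\<forall>i\<in>{..<d} - {0, 1}. f i = 0"
    proof
      fix i assume "i \<in> {..<d} - {0, 1}"
      hence "2 \<le> i" by auto
      thus "f i = 0" by (rule assms(2))
    qed
  qed (use assms(1) in auto)
  thus ?thesis by simp
qed

lemma nn_plane: "2 \<le> d \<Longrightarrow> adj4 u v \<Longrightarrow> nn d (plane L u) (plane L v)"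
  unfolding nn_def
proof (intro conjI plane_lattice)
  assume "2 \<le> d" "adj4 u v"
  thus "(\<Sum>i<d. \<bar>plane L u i - plane L v i\<bar>) = 1"
    by (subst sum_two_coords) (auto simp: plane_def adj4_def)
qed

text \<open>\<open>(1 + a\<^sup>2) * (1 + b\<^sup>2)\<close> is at most
  \<open>(1 + a\<^sup>2 + b\<^sup>2)\<^sup>2\<close>, so the decay splits into two summable
  one-dimensional factors. The constant 4 covers the near field.\<close>

lemma green_plane_le:
  assumes d: "16 \<le> d"
  shows "green d (plane L u) (plane L v) \<le>
    (4 + cgap) * ((1 / (1 + (real_of_int (int (fst v) - int (fst u)))\<^sup>2)) * (1 / (1 + (real_of_int (int (snd v) - int (snd u)))\<^sup>2)))"
proof -
  define a where "a = int (fst v) - int (fst u)"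
  define b where "b = int (snd v) - int (snd u)"
  define s where "s = a\<^sup>2 + b\<^sup>2"
  have "sqd d (\<lambda>j. plane L u j - plane L v j) = s"
    unfolding sqd_def by (subst sum_two_coords) (use d in \<open>auto simp: plane_def s_def a_def b_def power2_commute\<close>)
  hence g: "green d (plane L u) (plane L v) \<le> gmaj d s" using green_le[OF d] by metis
  have s0: "0 \<le> s" by (simp add: s_def)
  define P where "P = (1 + (real_of_int a)\<^sup>2) * (1 + (real_of_int b)\<^sup>2)"
  have P0: "0 < P" by (simp add: P_def add_pos_nonneg)
  have "P \<le> (1 + real_of_int s) * (1 + real_of_int s)"
    unfolding P_def s_def by (intro mult_mono) (auto simp: add_nonneg_nonneg)
  hence P: "P \<le> (1 + real_of_int s)\<^sup>2" by (simp add: power2_eq_square)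
  have "near d s * P \<le> near d s * (1 + real_of_int s)\<^sup>2"
    by (rule mult_left_mono[OF P]) (simp add: near_def)
  also have "\<dots> \<le> 4" using d by (auto simp: near_def divide_le_eq)
  finally have 1: "near d s * P \<le> 4" .
  have "cgap / (real d)\<^sup>2 / (28 + real_of_int s)\<^sup>2 * P \<le> cgap / (real d)\<^sup>2 / (28 + real_of_int s)\<^sup>2 * (28 + real_of_int s)\<^sup>2"
  proof (rule mult_left_mono)
    have "(1 + real_of_int s)\<^sup>2 \<le> (28 + real_of_int s)\<^sup>2" using s0 by (intro power_mono) auto
    thus "P \<le> (28 + real_of_int s)\<^sup>2" using P by linarith
  qed (simp add: cgap_def)
  also have "\<dots> = cgap / (real d)\<^sup>2" using s0 by simp
  also have "\<dots> \<le> cgap / 1" using d by (intro divide_left_mono) (auto simp: cgap_def)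
  finally have "gmaj d s * P \<le> 4 + cgap"
    using 1 by (simp add: gmaj_def cgap_def distrib_right)
  hence "gmaj d s \<le> (4 + cgap) / P" using P0 by (simp add: le_divide_eq)
  also have "\<dots> = (4 + cgap) * ((1 / (1 + (real_of_int a)\<^sup>2)) * (1 / (1 + (real_of_int b)\<^sup>2)))"
    by (simp add: P_def)
  finally show ?thesis using g unfolding a_def b_def by linarith
qed

text \<open>Each row of the covariance has a uniformly bounded sum, with 64 = 8 * 8 from the two
  coordinates.\<close>

lemma gvar_plane_le:
  assumes d: "16 \<le> d" and B: "finite B"
  shows "gvar d (plane L ` B) \<le> real (card B) * ((4 + cgap) * 64)"
proof -
  obtain m where m: "B \<subseteq> {..m} \<times> {..m}"
  proof -
    have "finite (fst ` B \<union> snd ` B)" using B by simp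
    then obtain m where "fst ` B \<union> snd ` B \<subseteq> {..m}" by (meson finite_nat_iff_bounded_le)
    hence "B \<subseteq> {..m} \<times> {..m}" by (fastforce simp: subset_iff image_iff)
    thus ?thesis using that by blast
  qed
  have inner: "(\<Sum>v\<in>B. green d (plane L u) (plane L v)) \<le> (4 + cgap) * 64" for u
  proof -
    let ?f = "\<lambda>j. 1 / (1 + (real_of_int (int j - int (fst u)))\<^sup>2)"
    let ?g = "\<lambda>j. 1 / (1 + (real_of_int (int j - int (snd u)))\<^sup>2)"
    have "(\<Sum>v\<in>B. green d (plane L u) (plane L v)) \<le> (\<Sum>v\<in>B. (4 + cgap) * (?f (fst v) * ?g (snd v)))"
      by (intro sum_mono green_plane_le[OF d])
    also have "\<dots> \<le> (\<Sum>v\<in>{..m}\<times>{..m}. (4 + cgap) * (?f (fst v) * ?g (snd v)))"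
      using m by (intro sum_mono2) (auto simp: cgap_def)
    also have "\<dots> = (4 + cgap) * ((\<Sum>j\<le>m. ?f j) * (\<Sum>j\<le>m. ?g j))"
      unfolding sum_product sum.cartesian_product case_prod_beta by (rule sum_distrib_left[symmetric])
    also have "\<dots> \<le> (4 + cgap) * (8 * 8)"
      by (intro mult_left_mono mult_mono sum_inverse_square_le sum_nonneg) (auto simp: cgap_def)
    finally show ?thesis by simp
  qed
  have "gvar d (plane L ` B) = (\<Sum>u\<in>B. \<Sum>v\<in>B. green d (plane L u) (plane L v))"
    unfolding gvar_def using inj_on_subset[OF inj_plane] by (simp add: sum.reindex)
  also have "\<dots> \<le> (\<Sum>u\<in>B. (4 + cgap) * 64)" by (intro sum_mono inner)
  finally show ?thesis by simp
qed

section \<open>Peierls bound for crossings at low levels\<close>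

lemma adj8_card: "finite {v. adj8 u v}" "card {v. adj8 u v} \<le> 9"
proof -
  let ?S = "{fst u - 1..Suc (fst u)} \<times> {snd u - 1..Suc (snd u)}"
  have sub: "{v. adj8 u v} \<subseteq> ?S" by (auto simp: adj8_def)
  thus "finite {v. adj8 u v}" by (rule finite_subset) simp
  have "card {v. adj8 u v} \<le> card ?S" using sub by (intro card_mono) auto
  also have "\<dots> \<le> 3 * 3" unfolding card_cartesian_product by (intro mult_le_mono) auto
  finally show "card {v. adj8 u v} \<le> 9" by simp
qed

lemma countable_lattice: "countable (lattice d)"
proof -
  have "lattice d \<subseteq> (\<Union>r. cube d (\<lambda>_. 0) r)"
  proof
    fix x assume x: "x \<in> lattice d"
    have "\<bar>x i\<bar> \<le> (\<Sum>i<d. \<bar>x i\<bar>)" if "i < d" for i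
      using that by (intro member_le_sum) auto
    hence "x \<in> cube d (\<lambda>_. 0) (nat (\<Sum>i<d. \<bar>x i\<bar>))" using x by (auto simp: cube_def sum_nonneg)
    thus "x \<in> (\<Union>r. cube d (\<lambda>_. 0) r)" by blast
  qed
  moreover have "countable (\<Union>r. cube d (\<lambda>_. 0) r)"
    by (rule countable_UN) (auto intro: countable_finite cube_card(1))
  ultimately show ?thesis by (rule countable_subset)
qed

text \<open>The event is a countable union over finite paths in a countable lattice.\<close>

lemma crossing_sets:
  assumes G: "is_GFF d M phi"
  shows "crossing d M phi h L \<in> sets M"
proof -
  define P where "P = {p. p \<noteq> [] \<and> hd p \<in> ball_inf d L \<and> last p \<in> sphere_inf d (2 * L) \<and> set p \<subseteq> lattice d
    \<and> (\<forall>k. Suc k < length p \<longrightarrow> nn d (p ! k) (p ! Suc k))}"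
  have "crossing d M phi h L = (\<Union>p\<in>P. {\<omega> \<in> space M. \<forall>x\<in>set p. h \<le> 1 * phi x \<omega>})"
    by (auto simp: crossing_def P_def)
  moreover have "countable P"
    by (rule countable_subset[OF _ countable_lists[OF countable_lattice[of d]]]) (auto simp: P_def)
  moreover have "{\<omega> \<in> space M. \<forall>x\<in>set p. h \<le> 1 * phi x \<omega>} \<in> sets M" if "p \<in> P" for p
    using that by (intro GFF_event_sets[OF G]) (auto simp: P_def)
  ultimately show ?thesis by (simp add: sets.countable_UN'')
qed

lemma open_path_crossing:
  assumes d: "2 \<le> d" and w: "\<omega> \<in> space M" and b: "b \<le> L" "b' \<le> L"
    and path: "(open_step (\<lambda>u. h \<le> phi (plane L u) \<omega>) (Suc L) L)\<^sup>*\<^sup>* (0, b) (Suc L, b')"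
  shows "\<omega> \<in> crossing d M phi h L"
proof -
  let ?R = "open_step (\<lambda>u. h \<le> phi (plane L u) \<omega>) (Suc L) L"
  obtain p where p: "p \<noteq> []" "hd p = (0, b)" "last p = (Suc L, b')" "successively ?R p"
      "\<forall>z\<in>set (tl p). \<exists>u. ?R u z"
    using rtranclp_distinct_path[OF path] by blast
  obtain q where q: "p = (0, b) # q" using p(1,2) by (cases p) auto
  have q0: "q \<noteq> []" using p(3) q by auto
  have "?R (0, b) (hd q)" using p(4) q q0 by (cases q) auto
  \<comment> \<open>The first step can only enter column 1 in the same row; dropping the start
    leaves a path that begins in the ball.\<close>
  hence hq: "hd q = (1, b)" by (cases "hd q") (auto simp: open_step_def adj4_def)
  have "successively ?R q" using p(4) q q0 by (simp add: successively_Cons)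
  hence "successively (\<lambda>u v. nn d (plane L u) (plane L v)) q"
    by (rule successively_mono) (auto simp: open_step_def intro: nn_plane[OF d])
  hence succ: "successively (nn d) (map (plane L) q)" by (simp add: successively_map)
  show ?thesis
    unfolding crossing_def
  proof (intro CollectI conjI w exI[of _ "map (plane L) q"])
    show "map (plane L) q \<noteq> []" using q0 by simp
    show "hd (map (plane L) q) \<in> ball_inf d L"
      using hq q0 b d plane_lattice[OF d] by (auto simp: hd_map ball_inf_def) (auto simp: plane_def)
    have "last q = (Suc L, b')" using p(3) q q0 by simp
    moreover have "\<exists>i<d. \<bar>plane L (Suc L, b') i\<bar> = int (2 * L)"
      using d by (intro exI[of _ 0]) (auto simp: plane_def)
    ultimately show "last (map (plane L) q) \<in> sphere_inf d (2 * L)"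
      using q0 b d plane_lattice[OF d] by (auto simp: last_map sphere_inf_def) (auto simp: plane_def)
    show "set (map (plane L) q) \<subseteq> lattice d" using plane_lattice[OF d] by auto
    show "\<forall>x\<in>set (map (plane L) q). h \<le> phi x \<omega>"
      using p(5) q by (auto simp: open_step_def)
    show "\<forall>k. Suc k < length (map (plane L) q) \<longrightarrow> nn d (map (plane L) q ! k) (map (plane L) q ! Suc k)"
      using successively_nth[OF succ] by blast
  qed
qed

text \<open>The height grows by at most one per step, so the path has at least \<open>n + 1\<close>
  vertices; truncating it gives walks of one fixed length, ready to be counted.\<close>

lemma closed_path_walk:
  assumes a: "\<not> Op (a, 0)" and path: "(closed_step Op m n)\<^sup>*\<^sup>* (a, 0) (a', n)"
  shows "\<exists>q\<in>walks adj8 n (a, 0). distinct q \<and> (\<forall>u\<in>set q. \<not> Op u)"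
proof -
  obtain p where p: "p \<noteq> []" "hd p = (a, 0)" "last p = (a', n)" "successively (closed_step Op m n) p"
      "distinct p" "\<forall>z\<in>set (tl p). \<exists>u. closed_step Op m n u z"
    using rtranclp_distinct_path[OF path] by blast
  have succ: "successively adj8 p"
    by (rule successively_mono[OF p(4)]) (simp add: closed_step_def)
  have "snd (p ! i) \<le> i" if "i < length p" for i
    using that
  proof (induction i)
    case 0 thus ?case using p by (simp add: hd_conv_nth[symmetric])
  next
    case (Suc i)
    have "adj8 (p ! i) (p ! Suc i)" by (rule successively_nth[OF succ Suc.prems])
    thus ?case using Suc by (auto simp: adj8_def)
  qed
  from this[of "length p - 1"] have len: "Suc n \<le> length p"
    using p(1,3) by (auto simp: last_conv_nth neq_Nil_conv)
  have cl: "\<not> Op u" if "u \<in> set p" for u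
    using that p(2,6) a by (cases p) (auto simp: closed_step_def)
  show ?thesis
  proof (rule bexI[of _ "take (Suc n) p"])
    show "take (Suc n) p \<in> walks adj8 n (a, 0)"
      using len p(2) successively_take[OF succ] by (auto simp: walks_def)
    show "distinct (take (Suc n) p) \<and> (\<forall>u\<in>set (take (Suc n) p). \<not> Op u)"
      using p(5) cl by (auto dest: in_set_takeD)
  qed
qed

text \<open>By duality, a failed crossing gives a self-avoiding 8-neighbour walk of
  \<open>L + 1\<close> vertices where the field is below \<open>- H\<close>. There are
  \<open>L + 1\<close> starts with at most \<open>9 ^ L\<close> walks each; the cost 1/18 = 1/(2 *
  9) per vertex leaves a total of at most 1/9.\<close>

lemma crossing_ge:
  assumes G: "is_GFF d M phi" and d: "16 \<le> d" and H: "0 \<le> H"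
    and Hbig: "exp (- H\<^sup>2 / (2 * ((4 + cgap) * 64))) \<le> 1 / 18"
  shows "8 / 9 \<le> measure M (crossing d M phi (- H) L)"
proof -
  interpret prob_space M using G by (simp add: is_GFF_def)
  define S where "S = (4 + cgap) * 64"
  have S: "0 < S" by (simp add: S_def cgap_def)
  let ?W = "\<lambda>a. {q \<in> walks adj8 L (a, 0). distinct q}"
  let ?E = "\<lambda>q. {\<omega> \<in> space M. \<forall>x\<in>plane L ` set q. H \<le> (-1) * phi x \<omega>}"
  have d2: "2 \<le> d" using d by simp
  have W: "finite (?W a)" "card (?W a) \<le> 9 ^ L" for a
  proof -
    have w: "finite (walks adj8 L (a, 0))" "card (walks adj8 L (a, 0)) \<le> 9 ^ L"
      using walks_card[of adj8 9] adj8_card by blast+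
    show "finite (?W a)" using w(1) by simp
    have "card (?W a) \<le> card (walks adj8 L (a, 0))" using w(1) by (intro card_mono) auto
    thus "card (?W a) \<le> 9 ^ L" using w(2) by linarith
  qed
  have E: "?E q \<in> sets M" for q
    using plane_lattice[OF d2] by (intro GFF_event_sets[OF G]) auto
  have Ele: "measure M (?E q) \<le> (1 / 18) ^ Suc L" if q: "q \<in> ?W a" for a q
  proof -
    have card: "card (set q) = Suc L" using q distinct_card[of q] by (auto simp: walks_def)
    have card': "card (plane L ` set q) = Suc L"
      using card_image[OF inj_on_subset[OF inj_plane]] card by (metis subset_UNIV)
    have "measure M (?E q) \<le> exp (- (H * real (card (plane L ` set q)))\<^sup>2 / (2 * (real (card (set q)) * S)))"
    proof (rule GFF_all_ge_le[OF G d])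
      show "plane L ` set q \<noteq> {}" using card by auto
      show "plane L ` set q \<subseteq> lattice d" using plane_lattice[OF d2] by auto
      show "gvar d (plane L ` set q) \<le> real (card (set q)) * S"
        unfolding S_def by (rule gvar_plane_le[OF d]) simp
    qed (use H in auto)
    also have "- (H * real (card (plane L ` set q)))\<^sup>2 / (2 * (real (card (set q)) * S)) = real (Suc L) * (- H\<^sup>2 / (2 * S))"
      unfolding card card' using S by (simp add: power2_eq_square field_simps del: of_nat_Suc)
    also have "exp \<dots> = exp (- H\<^sup>2 / (2 * S)) ^ Suc L" by (rule exp_of_nat_mult)
    also have "\<dots> \<le> (1 / 18) ^ Suc L" using Hbig unfolding S_def by (intro power_mono) auto
    finally show ?thesis .
  qed
  let ?Bad = "\<Union>a\<in>{1..Suc L}. \<Union>q\<in>?W a. ?E q"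
  have sub: "space M - crossing d M phi (- H) L \<subseteq> ?Bad"
  proof
    fix \<omega> assume w: "\<omega> \<in> space M - crossing d M phi (- H) L"
    let ?Op = "\<lambda>u. - H \<le> phi (plane L u) \<omega>"
    have "\<not> (\<exists>b\<le>L. \<exists>b'\<le>L. (open_step ?Op (Suc L) L)\<^sup>*\<^sup>* (0, b) (Suc L, b'))"
    proof safe
      fix b b' assume that: "b \<le> L" "b' \<le> L" "(open_step ?Op (Suc L) L)\<^sup>*\<^sup>* (0, b) (Suc L, b')"
      show False
        using open_path_crossing[where phi = phi and h = "- H" and \<omega> = \<omega> and M = M, OF d2 _ that] w by simp
    qed
    hence "\<exists>a\<in>{1..Suc L}. \<exists>a'\<in>{1..Suc L}. \<not> ?Op (a, 0) \<and> (closed_step ?Op (Suc L) L)\<^sup>*\<^sup>* (a, 0) (a', L)"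
      using rectangle_duality[of "Suc L" L ?Op, OF zero_less_Suc] by (simp only: simp_thms)
    then obtain a a' where a: "a \<in> {1..Suc L}" "\<not> ?Op (a, 0)" "(closed_step ?Op (Suc L) L)\<^sup>*\<^sup>* (a, 0) (a', L)"
      by (elim bexE conjE)
    obtain q where q: "q \<in> walks adj8 L (a, 0)" "distinct q" "\<forall>u\<in>set q. \<not> ?Op u"
      using closed_path_walk[of ?Op, OF a(2,3)] by blast
    have "\<omega> \<in> ?E q" using w q(3) by (auto simp: not_le)
    moreover have "q \<in> ?W a" using q(1,2) by simp
    ultimately show "\<omega> \<in> ?Bad" using a(1) by (intro UN_I)
  qed
  have "measure M (space M - crossing d M phi (- H) L) \<le> measure M ?Bad"
    using sub E W(1) by (intro finite_measure_mono sets.finite_UN) auto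
  also have "\<dots> \<le> (\<Sum>a\<in>{1..Suc L}. measure M (\<Union>q\<in>?W a. ?E q))"
    using E W(1) by (intro finite_measure_subadditive_finite) (auto intro!: sets.finite_UN)
  also have "\<dots> \<le> (\<Sum>a\<in>{1..Suc L}. \<Sum>q\<in>?W a. measure M (?E q))"
    using E W(1) by (intro sum_mono finite_measure_subadditive_finite) auto
  also have "\<dots> \<le> (\<Sum>a\<in>{1..Suc L}. \<Sum>q\<in>?W a. (1 / 18) ^ Suc L)"
    using Ele by (intro sum_mono) auto
  also have "\<dots> \<le> (\<Sum>a\<in>{1..Suc L}. 9 ^ L * (1 / 18) ^ Suc L)"
  proof (rule sum_mono)
    fix a
    have "real (card (?W a)) \<le> real (9 ^ L)" using W(2) by (rule of_nat_mono)
    thus "(\<Sum>q\<in>?W a. (1 / 18) ^ Suc L) \<le> (9::real) ^ L * (1 / 18) ^ Suc L"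
      unfolding sum_constant by (intro mult_right_mono) auto
  qed
  also have "\<dots> = real (Suc L) * (1 / 2) ^ Suc L / 9"
  proof -
    have "(9::real) ^ L * (1 / 18) ^ Suc L = (9 * (1 / 18)) ^ Suc L / 9"
      unfolding power_mult_distrib by simp
    thus ?thesis by simp
  qed
  also have "\<dots> \<le> 1 / 9"
  proof -
    have "real (Suc L) \<le> 2 ^ Suc L" using less_exp[of "Suc L"] by (metis less_imp_le of_nat_le_iff of_nat_numeral of_nat_power)
    thus ?thesis by (simp add: power_one_over field_simps)
  qed
  finally have "measure M (space M - crossing d M phi (- H) L) \<le> 1 / 9" .
  thus ?thesis using prob_compl[OF crossing_sets[OF G, of "- H" L]] by simp
qed

text \<open>Without this the infimum defining \<open>h_ss\<close> would be an unspecified real number.\<close>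

lemma critical_levels_bdd_below:
  assumes G: "is_GFF d M phi" and d: "16 \<le> d"
  shows "bdd_below {h. ((\<lambda>L. measure M (crossing d M phi h L)) \<longlongrightarrow> 0) sequentially}"
proof -
  define S where "S = (4 + cgap) * 64"
  have S: "0 < S" by (simp add: S_def cgap_def)
  \<comment> \<open>At this height the Gaussian cost per vertex equals exactly 1/18.\<close>
  define H0 where "H0 = sqrt (2 * S * ln 18)"
  have "- H0 \<le> h" if h: "(\<lambda>L. measure M (crossing d M phi h L)) \<longlonglongrightarrow> 0" for h
  proof (rule ccontr)
    assume "\<not> - H0 \<le> h"
    hence lt: "H0 \<le> - h" by simp
    have H0: "0 \<le> H0" using S by (simp add: H0_def)
    have "H0\<^sup>2 \<le> (- h)\<^sup>2" using lt H0 by (intro power_mono) auto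
    hence "2 * S * ln 18 \<le> (- h)\<^sup>2" using S by (simp add: H0_def)
    hence "ln 18 \<le> (- h)\<^sup>2 / (2 * S)" using S by (simp add: field_simps)
    hence "exp (- (- h)\<^sup>2 / (2 * S)) \<le> exp (- ln 18)" by simp
    also have "\<dots> = 1 / 18" by (simp add: exp_minus)
    finally have "exp (- (- h)\<^sup>2 / (2 * ((4 + cgap) * 64))) \<le> 1 / 18" unfolding S_def .
    hence "8 / 9 \<le> measure M (crossing d M phi h L)" for L
      using crossing_ge[OF G d, of "- h" L] lt H0 by simp
    hence "8 / 9 \<le> (0::real)" by (intro LIMSEQ_le_const[OF h]) auto
    thus False by simp
  qed
  thus ?thesis by (intro bdd_belowI[of _ "- H0"]) simp
qed

section \<open>Comparison of the critical level with the asymptotic level\<close>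

theorem theorem1p2:
  fixes M :: "nat \<Rightarrow> 'a measure" and phi :: "nat \<Rightarrow> (nat \<Rightarrow> int) \<Rightarrow> 'a \<Rightarrow> real"
  assumes "\<And>d. d \<ge> 3 \<Longrightarrow> is_GFF d (M d) (phi d)"
  shows "limsup (\<lambda>d. ereal (h_ss d (M d) (phi d) / h_as d)) \<le> 1"
proof (rule ereal_le_epsilon2)
  fix e :: real assume e: "0 < e"
  have "\<forall>\<^sub>F d in sequentially. ereal (h_ss d (M d) (phi d) / h_as d) \<le> ereal (1 + e)"
    using subcritical_level[OF e] eventually_ge_at_top[of 16]
  proof eventually_elim
    case (elim d)
    have G: "is_GFF d (M d) (phi d)" using assms elim(2) by simp
    have "0 < h_as d" using green0_ge_1[OF elim(2)] elim(2) by (simp add: h_as_def)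
    \<comment> \<open>The level \<open>(1 + e) * h_as d\<close> thus lies in the set whose infimum
      is \<open>h_ss\<close>, and that set is bounded below.\<close>
    have "(\<lambda>L. measure (M d) (crossing d (M d) (phi d) ((1 + e) * h_as d) L)) \<longlonglongrightarrow> 0"
      using elim(1) crossing_tendsto_0[OF G elim(2) _ _ _ refl] e \<open>0 < h_as d\<close> by force
    hence "h_ss d (M d) (phi d) \<le> (1 + e) * h_as d"
      unfolding h_ss_def by (intro cInf_lower critical_levels_bdd_below[OF G elim(2)]) simp
    thus ?case using \<open>0 < h_as d\<close> by (simp add: divide_le_eq)
  qed
  hence "limsup (\<lambda>d. ereal (h_ss d (M d) (phi d) / h_as d)) \<le> ereal (1 + e)"
    by (rule Limsup_bounded)
  thus "limsup (\<lambda>d. ereal (h_ss d (M d) (phi d) / h_as d)) \<le> 1 + ereal e"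
    by (simp add: one_ereal_def)
qed

end
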